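(* Consider the subset of $\mathcal{X}$ given by \begin{displaymath} N = \lbrace K \in \mathcal{X} \mid \forall n \in \mathbb{Z}_{>0} : \lvert \lbrace x \in \mathcal{O}_K \mid \max_i |x_i| < n \rbrace \rvert < \infty \rbrace, \end{displaymath} where for an algebraic integer $x$ with conjugates $x_1,\dots,x_m$ over $\mathbb{Q}$, $\max_i |x_i|$ denotes the house of $x$ (the largest absolute value of its conjugates); i.e.~$N$ is the set of totally real fields for which the ring of integers has the Northcott property (with respect to the house). Then $N$ is a meager subset of $\mathcal{X}$. In fact, already the superset \begin{displaymath} N' = \lbrace K \in \mathcal{X} \mid \lvert \lbrace x \in \mathcal{O}_K \mid \max_i |x_i| < 2 \rbrace \rvert < \infty \rbrace \end{displaymath} is meager.
   Context: $\mathbb{Q}^{\operatorname{tr}}$ denotes the field of all totally real algebraic numbers. $\mathcal X$ is the set of all subfields of $\mathbb{Q}^{\operatorname{tr}}$ (i.e.~all totally real fields), endowed with the constructible topology: the coarsest topology in which the sets $\lbrace K \in \mathcal X \mid a \in K \rbrace$ are both open and closed for all $a \in \mathbb{Q}^{\operatorname{tr}}$ (equivalently, the subspace topology from $2^{\mathbb{Q}^{\operatorname{tr}}}$ with the product of discrete topologies). $\mathcal{O}_K$ denotes the ring of algebraic integers in $K$. A subset is meager if it is a countable union of nowhere dense sets. *)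

theory Defs
  imports
    "HOL-Analysis.Analysis"
    "HOL-Computational_Algebra.Computational_Algebra"
begin

text \<open>
  The conjugates over the rationals: the complex roots of the minimal polynomial, which is
  determined up to a unit as the irreducible rational polynomial vanishing at \<open>x\<close>. The set is
  empty if \<open>x\<close> is transcendental.
\<close>
definition conjugates :: "complex \<Rightarrow> complex set" where
  "conjugates x = {y. \<exists>p :: rat poly. irreducible p \<and>
     poly (map_poly of_rat p) x = 0 \<and> poly (map_poly of_rat p) y = 0}"

definition house :: "complex \<Rightarrow> real" where
  "house x = Max (cmod ` conjugates x)"

definition totally_real_numbers :: "complex set" where
  "totally_real_numbers = {x. algebraic x \<and> conjugates x \<subseteq> \<real>}"

definition is_subfield :: "'a :: field set \<Rightarrow> bool" where
  "is_subfield K \<longleftrightarrow> 0 \<in> K \<and> 1 \<in> K \<and>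
     (\<forall>x\<in>K. \<forall>y\<in>K. x + y \<in> K \<and> x * y \<in> K) \<and> (\<forall>x\<in>K. - x \<in> K \<and> inverse x \<in> K)"

definition totally_real_fields :: "complex set set" where
  "totally_real_fields = {K. is_subfield K \<and> K \<subseteq> totally_real_numbers}"

definition ring_of_integers :: "complex set \<Rightarrow> complex set" where
  "ring_of_integers K = {x \<in> K. algebraic_int x}"

text \<open>The coarsest topology in which each \<open>{K. a \<in> K}\<close> and its complement are open.\<close>
definition constructible_topology :: "complex set topology" where
  "constructible_topology = topology_generated_by
     (\<Union>a\<in>totally_real_numbers. {{K \<in> totally_real_fields. a \<in> K},
                                 {K \<in> totally_real_fields. a \<notin> K}})"

definition nowhere_dense_in :: "'a topology \<Rightarrow> 'a set \<Rightarrow> bool" where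
  "nowhere_dense_in X S \<longleftrightarrow> S \<subseteq> topspace X \<and> X interior_of (X closure_of S) = {}"

definition meager_in :: "'a topology \<Rightarrow> 'a set \<Rightarrow> bool" where
  "meager_in X S \<longleftrightarrow> (\<exists>\<F>. countable \<F> \<and> (\<forall>A\<in>\<F>. nowhere_dense_in X A) \<and> S = \<Union>\<F>)"

lemma conjugates_0: "conjugates 0 = {0}"
proof (intro equalityI subsetI)
  fix y assume "y \<in> conjugates 0"
  then obtain p :: "rat poly" where p: "irreducible p"
    "poly (map_poly of_rat p) (0 :: complex) = 0" "poly (map_poly of_rat p) y = 0"
    by (auto simp: conjugates_def)
  have "coeff p 0 = 0"
    using p(2) by (simp add: poly_0_coeff_0 coeff_map_poly)
  then obtain q where q: "p = [:0, 1:] * q"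
    by (metis dvd_def poly_0_coeff_0 poly_eq_0_iff_dvd minus_zero)
  have "\<not> [:0, 1 :: rat:] dvd 1"
    by (simp add: is_unit_poly_iff)
  then have "q dvd 1"
    using irreducibleD[OF p(1) q] by blast
  then obtain c where c: "q = [:c:]" "c \<noteq> 0"
    by (metis dvd_0_left_iff is_unit_poly_iff zero_neq_one)
  show "y \<in> {0}"
    using p(3) q c by (simp add: map_poly_pCons)
next
  have "irreducible [:0, 1 :: rat:]"
    by (intro irreducible_linear_field_poly) simp
  then show "y \<in> conjugates 0" if "y \<in> {0}" for y
    using that unfolding conjugates_def by (auto intro!: exI[of _ "[:0, 1 :: rat:]"] simp: map_poly_pCons)
qed

lemma topspace_constructible_topology: "topspace constructible_topology = totally_real_fields"
proof -
  have "0 \<in> totally_real_numbers"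
    by (auto simp: totally_real_numbers_def conjugates_0)
  then show ?thesis
    by (auto simp: constructible_topology_def)
qed

end

theory Submission
  imports Defs "Jordan_Normal_Form.Char_Poly"
begin

text \<open>
  The numbers \<open>c\<^sub>p = 2 * cos (2 * pi / p)\<close> for odd primes \<open>p\<close> are totally real integers of house
  less than 2. A basic open set of fields prescribes finitely many elements, generating a number
  field \<open>K\<close>, and forbids finitely many numbers \<open>b \<notin> K\<close>. All but finitely many \<open>p\<close> are unramified
  in \<open>K(b)\<close>, whereas \<open>p\<close> is totally ramified in \<open>\<rat>(c\<^sub>p)\<close>, so \<open>c\<^sub>p\<close> has the same degree
  \<open>(p - 1) / 2\<close> over \<open>K\<close> and over \<open>K(b)\<close>, which forces \<open>b \<notin> K(c\<^sub>p)\<close>. Thus every nonempty open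
  set contains a field \<open>K(c\<^sub>p)\<close> with \<open>c\<^sub>p\<close> outside any given finite set \<open>F\<close>, and the fields whose integers of house less
  than 2 all lie in \<open>F\<close> form a nowhere dense set. There are only countably many choices of \<open>F\<close>.
\<close>


section \<open>Algebraic integers form a ring\<close>

text \<open>Ramification is expressed by divisibility between algebraic integers instead of ideals.
  Let \<open>p = 2 * n + 1\<close> be prime. For every conjugate \<open>y\<close> of
  \<open>c\<close>, the power \<open>(2 - y) ^ n\<close> is \<open>p\<close> times a unit. If
  \<open>c\<close> had degree \<open>e < n\<close> over K, the norm \<open>N\<close> of
  \<open>2 - c\<close> down to K would be a product of \<open>e\<close> such factors, so
  \<open>N ^ n\<close> would be \<open>p ^ e\<close> up to a unit. If \<open>p\<close> is unramified
  in K, it then divides \<open>N\<close>, and \<open>p ^ n\<close> divides \<open>p ^ e\<close>,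
  which is absurd. A field in the given open set may be an infinite extension in which every prime
  ramifies. This is why it is replaced by the subfield generated by the prescribed elements; the
  forbidden elements stay outside a smaller field. That almost all primes are unramified in a
  finitely generated field follows by adjoining one generator \<open>a\<close> at a time. In place
  of the discriminant, a common denominator of the coefficients of \<open>1 / m'(a)\<close> is
  excluded, where \<open>m\<close> is the minimal polynomial of \<open>a\<close>.\<close>

lemma algebraic_int_eigenvalue:
  fixes v :: "nat \<Rightarrow> complex"
  assumes v: "k < n" "v k \<noteq> 0"
    and z: "\<And>i. i < n \<Longrightarrow> z * v i = (\<Sum>j<n. of_int (A i j) * v j)"
  shows "algebraic_int z"
proof -
  define M :: "int mat" where "M = Matrix.mat n n (\<lambda>(i, j). A i j)"
  define M' :: "complex mat" where "M' = map_mat of_int M"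
  define w where "w = Matrix.vec n v"
  have M: "M \<in> carrier_mat n n" and M': "M' \<in> carrier_mat n n"
    by (auto simp: M_def M'_def)
  have "vec_index w k \<noteq> vec_index (0\<^sub>v n) k"
    using v by (simp add: w_def)
  then have "w \<noteq> 0\<^sub>v n"
    by metis
  moreover have "M' *\<^sub>v w = z \<cdot>\<^sub>v w"
    by (rule eq_vecI)
       (auto simp: M'_def M_def w_def scalar_prod_def z lessThan_atLeast0 intro!: sum.cong)
  ultimately have "eigenvalue M' z"
    unfolding eigenvalue_def eigenvector_def using M' by (intro exI[of _ w]) (auto simp: w_def)
  \<comment> \<open>The characteristic polynomial of an integer matrix is monic with integer
    coefficients, and \<open>z\<close> is one of its roots.\<close>
  then have "poly (char_poly M') z = 0"
    using eigenvalue_root_char_poly[OF M'] by blast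
  then have "poly (map_poly of_int (char_poly M)) z = 0"
    by (simp add: M'_def of_int_hom.char_poly_hom[OF M])
  moreover have "lead_coeff (char_poly M) = 1"
    using degree_monic_char_poly[OF M] by auto
  ultimately show ?thesis
    by (auto simp: algebraic_int_altdef_ipoly)
qed

text \<open>The \<int>-module generated by \<open>S\<close>. Only finite \<open>S\<close> are of
  interest, since a sum over an infinite set is 0.\<close>

definition int_span :: "complex set \<Rightarrow> complex set" where
  "int_span S = {x. \<exists>c. x = (\<Sum>s\<in>S. of_int (c s) * s)}"

lemma int_span_add: "x \<in> int_span S \<Longrightarrow> y \<in> int_span S \<Longrightarrow> x + y \<in> int_span S"
proof -
  assume "x \<in> int_span S" "y \<in> int_span S"
  then obtain c d where "x = (\<Sum>s\<in>S. of_int (c s) * s)" "y = (\<Sum>s\<in>S. of_int (d s) * s)"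
    by (auto simp: int_span_def)
  then have "x + y = (\<Sum>s\<in>S. of_int (c s + d s) * s)"
    by (simp add: sum.distrib algebra_simps)
  then show ?thesis
    unfolding int_span_def by (intro CollectI exI)
qed

lemma int_span_scale: "x \<in> int_span S \<Longrightarrow> of_int k * x \<in> int_span S"
proof -
  assume "x \<in> int_span S"
  then obtain c where "x = (\<Sum>s\<in>S. of_int (c s) * s)"
    by (auto simp: int_span_def)
  then have "of_int k * x = (\<Sum>s\<in>S. of_int (k * c s) * s)"
    by (simp add: sum_distrib_left mult.assoc)
  then show ?thesis
    unfolding int_span_def by (intro CollectI exI)
qed

lemma int_span_0: "0 \<in> int_span S"
  unfolding int_span_def by (auto intro!: exI[of _ "\<lambda>_. 0"])

lemma int_span_sum: "(\<And>i. i \<in> I \<Longrightarrow> f i \<in> int_span S) \<Longrightarrow> (\<Sum>i\<in>I. f i) \<in> int_span S"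
  by (induction I rule: infinite_finite_induct) (auto intro: int_span_add int_span_0)

lemma int_span_base: "finite S \<Longrightarrow> s \<in> S \<Longrightarrow> s \<in> int_span S"
  unfolding int_span_def
  by (auto intro!: exI[of _ "\<lambda>t. if t = s then 1 else 0"] simp: if_distrib if_distribR sum.delta cong: if_cong)

lemma int_span_mult:
  assumes "\<And>s. s \<in> S \<Longrightarrow> z * s \<in> int_span S" and "x \<in> int_span S"
  shows "z * x \<in> int_span S"
proof -
  obtain c where "x = (\<Sum>s\<in>S. of_int (c s) * s)"
    using assms(2) by (auto simp: int_span_def)
  then have "z * x = (\<Sum>s\<in>S. of_int (c s) * (z * s))"
    by (simp add: sum_distrib_left mult_ac)
  then show ?thesis
    using assms(1) by (auto intro!: int_span_sum int_span_scale)
qed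

text \<open>Multiplication by \<open>z\<close> acts on the generators through an integer matrix, and
  the vector listing \<open>S\<close> is an eigenvector for \<open>z\<close>; its entry 1 makes it
  nonzero.\<close>

lemma algebraic_int_int_span:
  assumes "finite S" "1 \<in> S" and z: "\<And>s. s \<in> S \<Longrightarrow> z * s \<in> int_span S"
  shows "algebraic_int z"
proof -
  obtain v :: "nat \<Rightarrow> complex" where v: "bij_betw v {..<card S} S"
    using ex_bij_betw_nat_finite[OF \<open>finite S\<close>] by (auto simp: lessThan_atLeast0)
  obtain k where k: "k < card S" "v k = 1"
    using v \<open>1 \<in> S\<close> unfolding bij_betw_def by (metis imageE lessThan_iff)
  from z have "\<forall>s\<in>S. \<exists>c. z * s = (\<Sum>t\<in>S. of_int (c t) * t)"
    by (auto simp: int_span_def)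
  then obtain c where c: "\<And>s. s \<in> S \<Longrightarrow> z * s = (\<Sum>t\<in>S. of_int (c s t) * t)"
    by metis
  show ?thesis
  proof (rule algebraic_int_eigenvalue[where v = v and n = "card S" and k = k
        and A = "\<lambda>i j. c (v i) (v j)"])
    fix i assume "i < card S"
    then have "v i \<in> S"
      using v by (auto simp: bij_betw_def)
    then show "z * v i = (\<Sum>j<card S. of_int (c (v i) (v j)) * v j)"
      using c sum.reindex_bij_betw[OF v, of "\<lambda>t. of_int (c (v i) t) * t"] by simp
  qed (use k in auto)
qed

lemma algebraic_int_power_reduce:
  fixes x :: complex
  assumes "algebraic_int x"
  obtains n a where "n > 0" "x ^ n = (\<Sum>i<n. of_int (a i) * x ^ i)"
proof -
  obtain p :: "int poly" where p: "poly (map_poly of_int p) x = 0" "lead_coeff p = 1"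
    using assms by (auto simp: algebraic_int_altdef_ipoly)
  have "degree p > 0"
  proof (rule ccontr)
    assume "\<not> degree p > 0"
    then obtain c where "p = [:c:]"
      by (metis degree_eq_zeroE not_gr_zero)
    with p show False
      by (auto simp: map_poly_pCons)
  qed
  moreover have "0 = (\<Sum>i\<le>degree p. of_int (coeff p i) * x ^ i)"
    using p(1) by (simp add: poly_altdef degree_map_poly coeff_map_poly)
  then have "x ^ degree p = (\<Sum>i<degree p. of_int (- coeff p i) * x ^ i)"
    using p(2) by (simp add: lessThan_Suc_atMost[symmetric] sum_negf eq_neg_iff_add_eq_0 add.commute)
  ultimately show ?thesis
    using that[of "degree p" "\<lambda>i. - coeff p i"] by simp
qed

lemma algebraic_int_plus_times:
  fixes x y :: complex
  assumes "algebraic_int x" "algebraic_int y"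
  shows "algebraic_int (x + y)" "algebraic_int (x * y)"
proof -
  obtain m a where m: "m > 0" "x ^ m = (\<Sum>i<m. of_int (a i) * x ^ i)"
    using algebraic_int_power_reduce[OF assms(1)] .
  obtain n b where n: "n > 0" "y ^ n = (\<Sum>i<n. of_int (b i) * y ^ i)"
    using algebraic_int_power_reduce[OF assms(2)] .
  \<comment> \<open>These monomials generate the module \<int>[x, y], because higher powers reduce
    by the two monic relations. Multiplication by \<open>x\<close> and by \<open>y\<close>
    stabilises the same module, hence so do \<open>x + y\<close> and \<open>x * y\<close>.\<close>
  define S where "S = (\<lambda>(i, j). x ^ i * y ^ j) ` ({..<m} \<times> {..<n})"
  have S: "finite S" "1 \<in> S"
    using m(1) n(1) by (auto simp: S_def intro!: image_eqI[of _ _ "(0, 0)"])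
  have base: "x ^ i * y ^ j \<in> int_span S" if "i < m" "j < n" for i j
    by (rule int_span_base) (use S that in \<open>auto simp: S_def\<close>)
  have X: "x * s \<in> int_span S" if "s \<in> S" for s
  proof -
    from that obtain i j where ij: "i < m" "j < n" "s = x ^ i * y ^ j"
      by (auto simp: S_def)
    show ?thesis
    proof (cases "Suc i = m")
      case True
      then have "x * s = x ^ m * y ^ j"
        using ij by auto
      also have "\<dots> = (\<Sum>i<m. of_int (a i) * (x ^ i * y ^ j))"
        by (simp add: m(2) sum_distrib_left sum_distrib_right mult_ac)
      also have "\<dots> \<in> int_span S"
        using ij by (auto intro!: int_span_sum int_span_scale base)
      finally show ?thesis .
    next
      case False
      then show ?thesis
        using base[of "Suc i" j] ij by (simp add: mult_ac)
    qed
  qed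
  have Y: "y * s \<in> int_span S" if "s \<in> S" for s
  proof -
    from that obtain i j where ij: "i < m" "j < n" "s = x ^ i * y ^ j"
      by (auto simp: S_def)
    show ?thesis
    proof (cases "Suc j = n")
      case True
      then have "y * s = y ^ n * x ^ i"
        using ij by auto
      also have "\<dots> = (\<Sum>j<n. of_int (b j) * (x ^ i * y ^ j))"
        by (simp add: n(2) sum_distrib_left sum_distrib_right mult_ac)
      also have "\<dots> \<in> int_span S"
        using ij by (auto intro!: int_span_sum int_span_scale base)
      finally show ?thesis .
    next
      case False
      then show ?thesis
        using base[of i "Suc j"] ij by (simp add: mult_ac)
    qed
  qed
  show "algebraic_int (x + y)"
    using S X Y by (intro algebraic_int_int_span[of S]) (auto simp: algebra_simps intro: int_span_add)
  show "algebraic_int (x * y)"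
    using S X Y by (intro algebraic_int_int_span[of S]) (auto simp: mult.assoc intro: int_span_mult)
qed

lemmas algebraic_int_plus = algebraic_int_plus_times(1)
lemmas algebraic_int_times = algebraic_int_plus_times(2)

lemma algebraic_int_power: "algebraic_int x \<Longrightarrow> algebraic_int (x ^ n)" for x :: complex
  by (induction n) (auto intro: algebraic_int_times)

lemma algebraic_int_sum: "(\<And>i. i \<in> I \<Longrightarrow> algebraic_int (f i)) \<Longrightarrow> algebraic_int (\<Sum>i\<in>I. f i)"
  for f :: "'a \<Rightarrow> complex"
  by (induction I rule: infinite_finite_induct) (auto intro: algebraic_int_plus)

lemma algebraic_int_prod: "(\<And>i. i \<in> I \<Longrightarrow> algebraic_int (f i)) \<Longrightarrow> algebraic_int (\<Prod>i\<in>I. f i)"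
  for f :: "'a \<Rightarrow> complex"
  by (induction I rule: infinite_finite_induct) (auto intro: algebraic_int_times)

lemma algebraic_int_poly:
  fixes x :: complex
  assumes "\<And>i. algebraic_int (coeff f i)" "algebraic_int x"
  shows "algebraic_int (poly f x)"
  unfolding poly_altdef using assms by (intro algebraic_int_sum algebraic_int_times algebraic_int_power)

lemma algebraic_int_coeff_mult:
  fixes f g :: "complex poly"
  assumes "\<And>i. algebraic_int (coeff f i)" "\<And>i. algebraic_int (coeff g i)"
  shows "algebraic_int (coeff (f * g) i)"
  unfolding coeff_mult using assms by (intro algebraic_int_sum algebraic_int_times)

lemma algebraic_int_coeff_prod_list:
  fixes xs :: "complex list"
  assumes "\<And>x. x \<in> set xs \<Longrightarrow> algebraic_int x"
  shows "algebraic_int (coeff (\<Prod>x\<leftarrow>xs. [:- x, 1:]) i)"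
  using assms
proof (induction xs arbitrary: i)
  case (Cons x xs)
  show ?case
    unfolding list.map prod_list.Cons
    by (intro algebraic_int_coeff_mult) (use Cons in \<open>auto simp: coeff_pCons split: nat.split\<close>)
qed auto

section \<open>Denominators of algebraic numbers\<close>

lemma algebraic_int_clear_denominator:
  fixes x :: complex
  assumes "algebraic x"
  obtains N :: int where "N \<noteq> 0" "algebraic_int (of_int N * x)"
proof -
  obtain p where p: "\<And>i. coeff p i \<in> \<int>" "p \<noteq> 0" "poly p x = 0"
    using assms by (elim algebraicE) auto
  define n where "n = degree p"
  obtain N where N: "lead_coeff p = of_int N"
    using p(1) Ints_cases by blast
  with p have "N \<noteq> 0"
    by auto
  have n: "n > 0"
  proof (rule ccontr)
    assume "\<not> n > 0"
    then obtain c where "p = [:c:]"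
      unfolding n_def by (metis degree_eq_zeroE not_gr_zero)
    with p show False
      by auto
  qed
  \<comment> \<open>These are the coefficients of \<open>N ^ (n - 1) * p\<close> as a polynomial in
    \<open>N * x\<close>: the power \<open>x ^ i\<close> absorbs \<open>N ^ i\<close>, and the
    leading coefficient becomes 1. The index \<open>n\<close> is separate because
    \<open>n - 1 - i\<close> would be truncated there.\<close>
  define c where "c = (\<lambda>i. if i = n then 1 else of_int N ^ (n - 1 - i) * coeff p i)"
  define q where "q = (\<Sum>i\<le>n. monom (c i) i)"
  have coeff_q: "coeff q i = (if i \<le> n then c i else 0)" for i
    by (simp add: q_def coeff_sum if_distrib if_distribR cong: if_cong)
  have "degree q = n"
    by (intro antisym degree_le le_degree) (auto simp: coeff_q c_def)
  then have "lead_coeff q = 1"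
    by (simp add: coeff_q c_def)
  moreover have "\<forall>i. coeff q i \<in> \<int>"
    using p(1) by (auto simp: coeff_q c_def)
  moreover have "poly q (of_int N * x) = 0"
  proof -
    have "poly q (of_int N * x) = (\<Sum>i\<le>n. c i * (of_int N * x) ^ i)"
      by (simp add: q_def poly_sum poly_monom)
    also have "\<dots> = (\<Sum>i\<le>n. of_int N ^ (n - 1) * (coeff p i * x ^ i))"
    proof (intro sum.cong refl)
      fix i assume "i \<in> {..n}"
      then consider "i = n" | "i < n" by force
      then show "c i * (of_int N * x) ^ i = of_int N ^ (n - 1) * (coeff p i * x ^ i)"
      proof cases
        case 1
        with n N show ?thesis
          by (cases n) (auto simp: c_def n_def power_mult_distrib)
      next
        case 2
        then have "(of_int N :: complex) ^ (n - 1) = of_int N ^ (n - 1 - i) * of_int N ^ i"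
          by (simp flip: power_add)
        with 2 show ?thesis
          by (auto simp: c_def power_mult_distrib)
      qed
    qed
    also have "\<dots> = of_int N ^ (n - 1) * poly p x"
      by (simp add: poly_altdef sum_distrib_left n_def)
    finally show ?thesis
      using p by simp
  qed
  ultimately have "algebraic_int (of_int N * x)"
    by (rule algebraic_int.intros)
  with \<open>N \<noteq> 0\<close> that show ?thesis by blast
qed

lemma algebraic_if_algebraic_int_multiple:
  fixes x :: complex
  assumes "algebraic_int (of_int N * x)" "N \<noteq> 0"
  shows "algebraic x"
proof -
  obtain q where q: "lead_coeff q = 1" "\<forall>i. coeff q i \<in> \<int>" "poly q (of_int N * x) = 0"
    using assms(1) by (auto simp: algebraic_int.simps)
  show ?thesis
  proof (rule algebraicI)
    show "poly (pcompose q [:0, of_int N:]) x = 0"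
      using q by (simp add: poly_pcompose mult.commute)
    show "pcompose q [:0, of_int N:] \<noteq> 0"
      using q assms by (auto simp: pcompose_eq_0_iff)
    show "coeff (pcompose q [:0, of_int N:]) i \<in> \<int>" for i
      using q by (intro coeff_pcompose_semiring_closed) (auto simp: coeff_pCons split: nat.split)
  qed
qed

lemma algebraic_plus_times:
  fixes x y :: complex
  assumes "algebraic x" "algebraic y"
  shows "algebraic (x + y)" "algebraic (x * y)"
proof -
  obtain M where M: "M \<noteq> 0" "algebraic_int (of_int M * x)"
    using assms(1) by (rule algebraic_int_clear_denominator)
  obtain N where N: "N \<noteq> 0" "algebraic_int (of_int N * y)"
    using assms(2) by (rule algebraic_int_clear_denominator)
  have "algebraic_int (of_int N * (of_int M * x) + of_int M * (of_int N * y))"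
    by (intro algebraic_int_plus algebraic_int_times[OF _ M(2)] algebraic_int_times[OF _ N(2)]) auto
  then have "algebraic_int (of_int (M * N) * (x + y))"
    by (simp add: algebra_simps)
  then show "algebraic (x + y)"
    using M N by (intro algebraic_if_algebraic_int_multiple[of "M * N"]) auto
  have "algebraic_int ((of_int M * x) * (of_int N * y))"
    by (rule algebraic_int_times[OF M(2) N(2)])
  then have "algebraic_int (of_int (M * N) * (x * y))"
    by (simp add: mult_ac)
  then show "algebraic (x * y)"
    using M N by (intro algebraic_if_algebraic_int_multiple[of "M * N"]) auto
qed

lemma is_subfield_algebraic: "is_subfield {x :: complex. algebraic x}"
  by (auto simp: is_subfield_def intro: algebraic_plus_times)

lemma clear_denominators_poly:
  fixes f :: "complex poly"
  assumes "\<And>i. algebraic (coeff f i)"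
  obtains N :: int where "N \<noteq> 0" "\<And>i. algebraic_int (of_int N * coeff f i)"
proof -
  have "\<exists>N::int. N \<noteq> 0 \<and> (\<forall>i<n. algebraic_int (of_int N * coeff f i))" for n
  proof (induction n)
    case (Suc n)
    then obtain N :: int where N: "N \<noteq> 0" "\<And>i. i < n \<Longrightarrow> algebraic_int (of_int N * coeff f i)"
      by blast
    obtain M where M: "M \<noteq> 0" "algebraic_int (of_int M * coeff f n)"
      using assms by (rule algebraic_int_clear_denominator)
    have "algebraic_int (of_int (M * N) * coeff f i)" if "i < Suc n" for i
    proof (cases "i = n")
      case True
      have "algebraic_int (of_int N * (of_int M * coeff f n))"
        by (intro algebraic_int_times[OF _ M(2)]) auto
      with True show ?thesis by (simp add: mult_ac)
    next
      case False
      then have "algebraic_int (of_int M * (of_int N * coeff f i))"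
        using that by (intro algebraic_int_times[OF _ N(2)]) auto
      then show ?thesis by (simp add: mult_ac)
    qed
    with M(1) N(1) show ?case
      by (intro exI[of _ "M * N"]) auto
  qed (auto intro: exI[of _ 1])
  then obtain N :: int where N: "N \<noteq> 0" "\<And>i. i \<le> degree f \<Longrightarrow> algebraic_int (of_int N * coeff f i)"
    by (metis less_Suc_eq_le)
  have "algebraic_int (of_int N * coeff f i)" for i
    using N(2)[of i] by (cases "i \<le> degree f") (auto simp: coeff_eq_0)
  with N that show ?thesis by blast
qed

section \<open>Polynomials over subfields and simple extensions\<close>

locale complex_subfield =
  fixes K :: "complex set"
  assumes is_subfield: "is_subfield K"
begin

lemma zero_closed [simp, intro]: "0 \<in> K" and one_closed [simp, intro]: "1 \<in> K"
  and add_closed [intro]: "x \<in> K \<Longrightarrow> y \<in> K \<Longrightarrow> x + y \<in> K"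
  and mult_closed [intro]: "x \<in> K \<Longrightarrow> y \<in> K \<Longrightarrow> x * y \<in> K"
  and uminus_closed [intro]: "x \<in> K \<Longrightarrow> - x \<in> K"
  and inverse_closed [intro]: "x \<in> K \<Longrightarrow> inverse x \<in> K"
  using is_subfield by (auto simp: is_subfield_def)

lemma diff_closed [intro]: "x \<in> K \<Longrightarrow> y \<in> K \<Longrightarrow> x - y \<in> K"
  using add_closed[of x "- y"] by auto

lemma power_closed [intro]: "x \<in> K \<Longrightarrow> x ^ n \<in> K"
  by (induction n) auto

lemma sum_closed [intro]: "(\<And>i. i \<in> I \<Longrightarrow> f i \<in> K) \<Longrightarrow> sum f I \<in> K"
  by (induction I rule: infinite_finite_induct) auto

lemma of_nat_closed [simp, intro]: "of_nat n \<in> K"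
  by (induction n) auto

lemma of_int_closed [simp, intro]: "of_int n \<in> K"
  by (cases n rule: int_diff_cases) auto

lemma Rats_subset: "\<rat> \<subseteq> K"
proof
  fix x :: complex assume "x \<in> \<rat>"
  then obtain a b where "x = of_int a / of_int b"
    by (auto elim: Rats_cases')
  then show "x \<in> K"
    by (auto simp: divide_inverse)
qed

end

text \<open>Fields are sets of complex numbers rather than types, so K[X] is a set of complex
  polynomials and membership of the coefficients is tracked explicitly.\<close>

definition polys_over :: "'a :: zero set \<Rightarrow> 'a poly set" where
  "polys_over K = {f. \<forall>i. coeff f i \<in> K}"

lemma polys_overI: "(\<And>i. coeff f i \<in> K) \<Longrightarrow> f \<in> polys_over K"
  and polys_overD: "f \<in> polys_over K \<Longrightarrow> coeff f i \<in> K"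
  by (auto simp: polys_over_def)

lemma polys_over_mono: "K \<subseteq> L \<Longrightarrow> polys_over K \<subseteq> polys_over L"
  by (auto simp: polys_over_def)

context complex_subfield
begin

lemma polys_over_closed [intro]:
  shows polys_over_0: "0 \<in> polys_over K"
    and polys_over_1: "1 \<in> polys_over K"
    and polys_over_add: "f \<in> polys_over K \<Longrightarrow> g \<in> polys_over K \<Longrightarrow> f + g \<in> polys_over K"
    and polys_over_diff: "f \<in> polys_over K \<Longrightarrow> g \<in> polys_over K \<Longrightarrow> f - g \<in> polys_over K"
    and polys_over_mult: "f \<in> polys_over K \<Longrightarrow> g \<in> polys_over K \<Longrightarrow> f * g \<in> polys_over K"
    and polys_over_smult: "c \<in> K \<Longrightarrow> f \<in> polys_over K \<Longrightarrow> Polynomial.smult c f \<in> polys_over K"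
    and polys_over_pCons: "c \<in> K \<Longrightarrow> f \<in> polys_over K \<Longrightarrow> pCons c f \<in> polys_over K"
    and polys_over_monom: "c \<in> K \<Longrightarrow> monom c n \<in> polys_over K"
    and polys_over_pderiv: "f \<in> polys_over K \<Longrightarrow> pderiv f \<in> polys_over K"
  by (auto simp: polys_over_def coeff_mult coeff_pCons coeff_pderiv split: nat.split simp del: of_nat_Suc)

lemma polys_over_power [intro]: "f \<in> polys_over K \<Longrightarrow> f ^ n \<in> polys_over K"
  by (induction n) auto

lemma poly_closed [intro]: "f \<in> polys_over K \<Longrightarrow> x \<in> K \<Longrightarrow> poly f x \<in> K"
  unfolding poly_altdef by (auto dest: polys_overD)

lemma polys_over_pcompose [intro]:
  "f \<in> polys_over K \<Longrightarrow> g \<in> polys_over K \<Longrightarrow> pcompose f g \<in> polys_over K"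
proof (induction f)
  case (pCons a f)
  have "f \<in> polys_over K"
    using pCons.prems(1) by (auto simp: polys_over_def) (metis coeff_pCons_Suc)
  moreover have "a \<in> K"
    using polys_overD[OF pCons.prems(1), of 0] by simp
  ultimately show ?case
    using pCons by (auto simp: pcompose_pCons)
qed auto

lemma polys_over_Ints: "\<forall>i. coeff f i \<in> \<int> \<Longrightarrow> f \<in> polys_over K"
  by (metis Ints_cases of_int_closed polys_overI)

lemma polys_over_monic_division:
  assumes "f \<in> polys_over K" "m \<in> polys_over K" "lead_coeff m = 1"
  obtains q r where "q \<in> polys_over K" "r \<in> polys_over K" "f = q * m + r"
    "r = 0 \<or> degree r < degree m"
proof -
  \<comment> \<open>Degree bounds are phrased as vanishing of coefficients, so that the zero
    polynomial fits in. Each round cancels the coefficient of index \<open>n\<close>, without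
    division because \<open>m\<close> is monic.\<close>
  have "\<exists>q\<in>polys_over K. \<exists>r\<in>polys_over K. f = q * m + r \<and> (\<forall>i\<ge>degree m. coeff r i = 0)"
    if "f \<in> polys_over K" "\<forall>i\<ge>n. coeff f i = 0" for n f
    using that
  proof (induction n arbitrary: f)
    case 0
    then have "f = 0" by (auto simp: poly_eq_iff)
    then show ?case by (intro bexI[of _ 0]) auto
  next
    case (Suc n)
    show ?case
    proof (cases "Suc n \<le> degree m")
      case True
      with Suc.prems show ?thesis
        by (intro bexI[of _ 0] bexI[of _ f]) auto
    next
      case False
      define t where "t = monom (coeff f n) (n - degree m)"
      have t: "t \<in> polys_over K"
        using Suc.prems by (auto simp: t_def dest: polys_overD)
      have "coeff (f - t * m) i = 0" if "i \<ge> n" for i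
      proof (cases "i = n")
        case True
        with False assms(3) show ?thesis
          by (auto simp: t_def coeff_monom_mult)
      next
        case i: False
        with that have "coeff f i = 0" "coeff m (i - (n - degree m)) = 0"
          using Suc.prems(2) False by (auto intro!: coeff_eq_0)
        then show ?thesis
          by (simp add: t_def coeff_monom_mult)
      qed
      moreover have "f - t * m \<in> polys_over K"
        using t Suc.prems assms by auto
      ultimately have "\<exists>q\<in>polys_over K. \<exists>r\<in>polys_over K.
          f - t * m = q * m + r \<and> (\<forall>i\<ge>degree m. coeff r i = 0)"
        by (intro Suc.IH) auto
      then obtain q r where qr: "q \<in> polys_over K" "r \<in> polys_over K"
        "f - t * m = q * m + r" "\<forall>i\<ge>degree m. coeff r i = 0"
        by blast
      then have "f = (q + t) * m + r"
        by (simp add: algebra_simps)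
      with qr t show ?thesis
        by (intro bexI[of _ "q + t"] bexI[of _ r]) auto
    qed
  qed
  from this[OF assms(1), of "Suc (degree f)"] obtain q r where qr: "q \<in> polys_over K" "r \<in> polys_over K"
    "f = q * m + r" "\<forall>i\<ge>degree m. coeff r i = 0"
    by (auto simp: coeff_eq_0)
  then have "r = 0 \<or> degree r < degree m"
    by (metis leading_coeff_0_iff not_le_imp_less)
  with qr that show ?thesis by blast
qed

lemma minimal_polynomial:
  assumes "algebraic a"
  obtains m where "m \<in> polys_over K" "lead_coeff m = 1" "poly m a = 0" "degree m > 0"
    "\<And>f. f \<in> polys_over K \<Longrightarrow> poly f a = 0 \<Longrightarrow> \<exists>q\<in>polys_over K. f = q * m"
    "\<And>f. f \<in> polys_over K \<Longrightarrow> poly f a = 0 \<Longrightarrow> f \<noteq> 0 \<Longrightarrow> degree m \<le> degree f"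
proof -
  define P where "P f \<longleftrightarrow> f \<in> polys_over K \<and> poly f a = 0 \<and> f \<noteq> 0" for f
  obtain f0 where "\<And>i. coeff f0 i \<in> \<int>" "f0 \<noteq> 0" "poly f0 a = 0"
    using assms by (elim algebraicE) auto
  then have "P f0"
    by (simp add: P_def polys_over_Ints)
  then obtain f where f: "P f" "\<And>g. P g \<Longrightarrow> degree f \<le> degree g"
    using ex_has_least_nat[of P f0 degree] by blast
  define m where "m = Polynomial.smult (inverse (lead_coeff f)) f"
  have m: "m \<in> polys_over K" "lead_coeff m = 1" "poly m a = 0" "degree m = degree f"
    using f(1) by (auto simp: m_def P_def dest: polys_overD)
  have min: "degree m \<le> degree g" if "g \<in> polys_over K" "poly g a = 0" "g \<noteq> 0" for g
    using f(2)[of g] that m(4) by (auto simp: P_def)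
  have "degree m > 0"
  proof (rule ccontr)
    assume "\<not> degree m > 0"
    then obtain c where "m = [:c:]"
      by (metis degree_eq_zeroE not_gr_zero)
    with m show False by auto
  qed
  moreover have "\<exists>q\<in>polys_over K. g = q * m" if g: "g \<in> polys_over K" "poly g a = 0" for g
  proof -
    obtain q r where qr: "q \<in> polys_over K" "r \<in> polys_over K" "g = q * m + r" "r = 0 \<or> degree r < degree m"
      using polys_over_monic_division[OF g(1) m(1,2)] .
    then have "poly r a = 0"
      using g m by auto
    with qr min[of r] have "r = 0"
      by fastforce
    with qr show ?thesis by auto
  qed
  ultimately show ?thesis
    using that[OF m(1-3)] min by blast
qed

end

text \<open>The ring K[a]. It is already the field K(a) if \<open>K\<close> is a field of algebraic
  numbers and \<open>a\<close> is algebraic.\<close>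

definition adjoin :: "complex set \<Rightarrow> complex \<Rightarrow> complex set" where
  "adjoin K a = (\<lambda>f. poly f a) ` polys_over K"

locale algebraic_subfield = complex_subfield +
  assumes algebraic: "K \<subseteq> {x. algebraic x}"
begin

lemma adjoinI [intro]: "f \<in> polys_over K \<Longrightarrow> poly f a \<in> adjoin K a"
  by (auto simp: adjoin_def)

lemma subset_adjoin: "K \<subseteq> adjoin K a"
proof
  fix x assume "x \<in> K"
  then have "poly [:x:] a \<in> adjoin K a" by blast
  then show "x \<in> adjoin K a" by simp
qed

lemma generator_in_adjoin: "a \<in> adjoin K a"
proof -
  have "poly [:0, 1:] a \<in> adjoin K a" by blast
  then show ?thesis by simp
qed

lemma adjoin_subset:
  assumes "is_subfield F" "K \<subseteq> F" "a \<in> F"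
  shows "adjoin K a \<subseteq> F"
proof -
  interpret F: complex_subfield F
    by unfold_locales fact
  show ?thesis
    using assms polys_over_mono[of K F] by (auto simp: adjoin_def)
qed

lemma adjoin_add: "x \<in> adjoin K a \<Longrightarrow> y \<in> adjoin K a \<Longrightarrow> x + y \<in> adjoin K a"
  and adjoin_mult: "x \<in> adjoin K a \<Longrightarrow> y \<in> adjoin K a \<Longrightarrow> x * y \<in> adjoin K a"
  by (auto simp: adjoin_def simp flip: poly_add poly_mult)

lemma adjoin_sum: "(\<And>i. i \<in> I \<Longrightarrow> f i \<in> adjoin K a) \<Longrightarrow> (\<Sum>i\<in>I. f i) \<in> adjoin K a"
  using subset_adjoin by (induction I rule: infinite_finite_induct) (auto intro: adjoin_add)

lemma adjoin_power: "x \<in> adjoin K a \<Longrightarrow> x ^ n \<in> adjoin K a"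
  using subset_adjoin by (induction n) (auto intro: adjoin_mult)

lemma algebraic_subfield_adjoin:
  assumes "algebraic a"
  shows "algebraic_subfield (adjoin K a)"
proof -
  have alg: "adjoin K a \<subseteq> {x. algebraic x}"
    using is_subfield_algebraic algebraic assms by (intro adjoin_subset) auto
  have "inverse y \<in> adjoin K a" if y: "y \<in> adjoin K a" for y
  proof (cases "y = 0")
    case True
    with y show ?thesis by simp
  next
    case False
    \<comment> \<open>An integer relation \<open>c + y * q(y) = 0\<close> with \<open>c\<close>
      nonzero gives \<open>1 / y = - q(y) / c\<close>, and \<open>q(y)\<close> stays in
      K[a].\<close>
    then obtain p where p: "coeff p 0 \<noteq> 0" "poly (map_poly of_int p) y = 0"
      using algebraicE'_nonzero[of y] alg y by blast
    obtain c q where cq: "p = pCons c q"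
      by (metis pCons_cases)
    have "poly (map_poly of_int q) y \<in> adjoin K a"
      unfolding poly_altdef using subset_adjoin y
      by (auto simp: coeff_map_poly intro!: adjoin_sum adjoin_mult adjoin_power)
    moreover have "inverse (of_int (- c)) \<in> adjoin K a"
      using subset_adjoin of_int_closed by blast
    moreover have "inverse y = inverse (of_int (- c)) * poly (map_poly of_int q) y"
      using p False unfolding cq by (auto simp: map_poly_pCons field_simps add_eq_0_iff2)
    ultimately show ?thesis
      by (metis adjoin_mult)
  qed
  moreover have "- y \<in> adjoin K a" if "y \<in> adjoin K a" for y
  proof -
    have "- 1 \<in> adjoin K a"
      using subset_adjoin uminus_closed[OF one_closed] by blast
    from adjoin_mult[OF this that] show ?thesis by simp
  qed
  ultimately have "is_subfield (adjoin K a)"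
    unfolding is_subfield_def
    using subsetD[OF subset_adjoin zero_closed] subsetD[OF subset_adjoin one_closed]
    by (auto intro: adjoin_add adjoin_mult)
  with alg show ?thesis
    by unfold_locales auto
qed

lemma adjoin_reduce:
  assumes "y \<in> adjoin K a" "g \<in> polys_over K" "lead_coeff g = 1" "poly g a = 0" "degree g > 0"
  obtains f where "f \<in> polys_over K" "y = poly f a" "degree f < degree g"
proof -
  obtain f where f: "f \<in> polys_over K" "y = poly f a"
    using assms(1) by (auto simp: adjoin_def)
  obtain q r where "q \<in> polys_over K" "r \<in> polys_over K" "f = q * g + r" "r = 0 \<or> degree r < degree g"
    using polys_over_monic_division[OF f(1) assms(2,3)] .
  with f assms that[of r] show ?thesis by auto
qed

end

lemma algebraic_subfield_Rats: "algebraic_subfield \<rat>"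
  by unfold_locales (auto simp: is_subfield_def intro: rat_imp_algebraic)

section \<open>Embeddings and conjugates\<close>

text \<open>A function on all complex numbers of which only the values on \<open>K\<close> matter;
  \<open>\<sigma> 1 = 1\<close> excludes the zero map.\<close>

definition field_embedding :: "complex set \<Rightarrow> (complex \<Rightarrow> complex) \<Rightarrow> bool" where
  "field_embedding K \<sigma> \<longleftrightarrow> \<sigma> 1 = 1 \<and>
     (\<forall>x\<in>K. \<forall>y\<in>K. \<sigma> (x + y) = \<sigma> x + \<sigma> y \<and> \<sigma> (x * y) = \<sigma> x * \<sigma> y)"

locale embedded_field = algebraic_subfield +
  fixes \<sigma> :: "complex \<Rightarrow> complex"
  assumes embedding: "field_embedding K \<sigma>"
begin

lemma map_1 [simp]: "\<sigma> 1 = 1"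
  and map_add: "x \<in> K \<Longrightarrow> y \<in> K \<Longrightarrow> \<sigma> (x + y) = \<sigma> x + \<sigma> y"
  and map_mult: "x \<in> K \<Longrightarrow> y \<in> K \<Longrightarrow> \<sigma> (x * y) = \<sigma> x * \<sigma> y"
  using embedding by (auto simp: field_embedding_def)

lemma map_0 [simp]: "\<sigma> 0 = 0"
  using map_add[of 0 0] by simp

lemma map_uminus: "x \<in> K \<Longrightarrow> \<sigma> (- x) = - \<sigma> x"
  using map_add[of x "- x"] by (simp add: eq_neg_iff_add_eq_0 add.commute uminus_closed)

lemma map_inverse: "x \<in> K \<Longrightarrow> \<sigma> (inverse x) = inverse (\<sigma> x)"
  using map_mult[of x "inverse x"] by (cases "x = 0") (auto simp: inverse_closed inverse_unique)

lemma map_sum: "(\<And>i. i \<in> I \<Longrightarrow> f i \<in> K) \<Longrightarrow> \<sigma> (\<Sum>i\<in>I. f i) = (\<Sum>i\<in>I. \<sigma> (f i))"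
  by (induction I rule: infinite_finite_induct) (auto simp: map_add sum_closed)

lemma map_power: "x \<in> K \<Longrightarrow> \<sigma> (x ^ n) = \<sigma> x ^ n"
  by (induction n) (auto simp: map_mult power_closed)

lemma map_of_nat: "\<sigma> (of_nat n) = of_nat n"
  by (induction n) (auto simp: map_add)

lemma map_of_int: "\<sigma> (of_int n) = of_int n"
  by (cases n rule: int_cases2) (auto simp: map_of_nat map_uminus)

lemma map_rat:
  assumes "x \<in> \<rat>"
  shows "\<sigma> x = x"
proof -
  obtain a b where "x = of_int a / of_int b"
    using assms by (auto elim: Rats_cases')
  then show ?thesis
    by (simp add: divide_inverse map_mult map_inverse map_of_int inverse_closed)
qed

lemma map_poly_embedding_add:
  "f \<in> polys_over K \<Longrightarrow> g \<in> polys_over K \<Longrightarrow> map_poly \<sigma> (f + g) = map_poly \<sigma> f + map_poly \<sigma> g"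
  by (auto simp: poly_eq_iff coeff_map_poly polys_overD map_add)

lemma map_poly_embedding_mult:
  "f \<in> polys_over K \<Longrightarrow> g \<in> polys_over K \<Longrightarrow> map_poly \<sigma> (f * g) = map_poly \<sigma> f * map_poly \<sigma> g"
  by (auto simp: poly_eq_iff coeff_map_poly coeff_mult polys_overD map_sum map_mult mult_closed)

lemma map_poly_eval:
  assumes "f \<in> polys_over K" "x \<in> K"
  shows "\<sigma> (poly f x) = poly (map_poly \<sigma> f) (\<sigma> x)"
proof -
  have "\<sigma> (poly f x) = (\<Sum>i\<le>degree f. coeff (map_poly \<sigma> f) i * \<sigma> x ^ i)"
    using assms by (auto simp: poly_altdef map_sum map_mult map_power polys_overD mult_closed
        power_closed coeff_map_poly intro!: sum.cong)
  also have "\<dots> = poly (map_poly \<sigma> f) (\<sigma> x)"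
    unfolding poly_altdef
    by (intro sum.mono_neutral_right) (auto simp: coeff_eq_0 map_poly_degree_leq intro: order.trans)
  finally show ?thesis .
qed

text \<open>K(a) is K[X] modulo the relations of \<open>a\<close>, so sending \<open>f(a)\<close> to
  the value of \<open>map_poly \<sigma> f\<close> at \<open>a'\<close> is well defined once
  \<open>a'\<close> satisfies the image of every relation.\<close>

lemma extend_embedding:
  assumes a: "algebraic a"
    and a': "\<And>f. f \<in> polys_over K \<Longrightarrow> poly f a = 0 \<Longrightarrow> poly (map_poly \<sigma> f) a' = 0"
  obtains \<tau> where "embedded_field (adjoin K a) \<tau>" "\<And>x. x \<in> K \<Longrightarrow> \<tau> x = \<sigma> x" "\<tau> a = a'"
proof -
  define r where "r x = (SOME f. f \<in> polys_over K \<and> poly f a = x)" for x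
  define \<tau> where "\<tau> x = poly (map_poly \<sigma> (r x)) a'" for x
  have \<tau>: "\<tau> (poly f a) = poly (map_poly \<sigma> f) a'" if f: "f \<in> polys_over K" for f
  proof -
    have r: "r (poly f a) \<in> polys_over K \<and> poly (r (poly f a)) a = poly f a"
      unfolding r_def by (rule someI[of _ f]) (use f in auto)
    \<comment> \<open>The chosen representative and \<open>f\<close> differ by a relation of
      \<open>a\<close>, so the choice does not affect the value at \<open>a'\<close>.\<close>
    then have "poly (map_poly \<sigma> (r (poly f a) - f)) a' = 0"
      using f by (intro a') auto
    moreover have "map_poly \<sigma> (r (poly f a)) = map_poly \<sigma> (r (poly f a) - f) + map_poly \<sigma> f"
      using r f by (subst map_poly_embedding_add[symmetric]) auto
    ultimately show ?thesis
      by (simp add: \<tau>_def)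
  qed
  have const: "\<tau> x = \<sigma> x" if "x \<in> K" for x
  proof -
    have "map_poly \<sigma> [:x:] = [:\<sigma> x:]"
      by (rule poly_eqI) (simp add: coeff_map_poly coeff_pCons split: nat.split)
    then show ?thesis
      using \<tau>[of "[:x:]"] that by (simp add: polys_over_pCons polys_over_0)
  qed
  have "\<tau> a = a'"
  proof -
    have "map_poly \<sigma> [:0, 1:] = [:0, 1:]"
      by (rule poly_eqI) (simp add: coeff_map_poly coeff_pCons split: nat.split)
    then show ?thesis
      using \<tau>[of "[:0, 1:]"] by (simp add: polys_over_pCons polys_over_0)
  qed
  moreover have "field_embedding (adjoin K a) \<tau>"
    unfolding field_embedding_def
  proof (intro conjI ballI)
    show "\<tau> 1 = 1" by (simp add: const)
  next
    fix x y assume "x \<in> adjoin K a" "y \<in> adjoin K a"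
    then obtain f g where fg: "f \<in> polys_over K" "g \<in> polys_over K" "x = poly f a" "y = poly g a"
      by (auto simp: adjoin_def)
    show "\<tau> (x + y) = \<tau> x + \<tau> y"
      using \<tau>[of "f + g"] fg by (auto simp: \<tau> map_poly_embedding_add)
    show "\<tau> (x * y) = \<tau> x * \<tau> y"
      using \<tau>[of "f * g"] fg by (auto simp: \<tau> map_poly_embedding_mult)
  qed
  then have "embedded_field (adjoin K a) \<tau>"
    unfolding embedded_field_def embedded_field_axioms_def
    using algebraic_subfield_adjoin[OF a] by blast
  ultimately show ?thesis
    using that const by blast
qed

lemma exists_extension:
  assumes "algebraic a"
  obtains \<tau> where "embedded_field (adjoin K a) \<tau>" "\<And>x. x \<in> K \<Longrightarrow> \<tau> x = \<sigma> x"
proof -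
  obtain m where m: "m \<in> polys_over K" "lead_coeff m = 1" "degree m > 0"
    "\<And>f. f \<in> polys_over K \<Longrightarrow> poly f a = 0 \<Longrightarrow> \<exists>q\<in>polys_over K. f = q * m"
    using minimal_polynomial[OF assms] by metis
  \<comment> \<open>The leading coefficient 1 is fixed by \<open>\<sigma>\<close>, so the image of
    the minimal polynomial is not constant and has a complex root to serve as
    \<open>a'\<close>.\<close>
  have "coeff (map_poly \<sigma> m) (degree m) \<noteq> 0"
    using m by (simp add: coeff_map_poly)
  then have "degree (map_poly \<sigma> m) > 0"
    using m(3) le_degree order_less_le_trans by blast
  then have "\<not> constant (poly (map_poly \<sigma> m))"
    by (simp add: constant_degree)
  then obtain a' where a': "poly (map_poly \<sigma> m) a' = 0"
    using fundamental_theorem_of_algebra by blast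
  have "poly (map_poly \<sigma> f) a' = 0" if "f \<in> polys_over K" "poly f a = 0" for f
    using m(4)[OF that] m(1) a' by (auto simp: map_poly_embedding_mult)
  then show ?thesis
    using extend_embedding[OF assms] that by metis
qed

end

section \<open>Conjugates and rational relations\<close>

lemma polys_over_Rats:
  assumes "f \<in> polys_over (\<rat> :: complex set)"
  obtains g where "f = map_poly of_rat g"
proof
  let ?h = "inv_into UNIV (of_rat :: rat \<Rightarrow> complex)"
  have inj: "inj (of_rat :: rat \<Rightarrow> complex)"
    by (auto simp: inj_def)
  have "?h 0 = 0"
    using inv_f_f[OF inj, of 0] by simp
  moreover have "of_rat (?h x) = x" if "x \<in> \<rat>" for x :: complex
    using that by (auto simp: Rats_def intro: f_inv_into_f)
  ultimately show "f = map_poly of_rat (map_poly ?h f)"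
    using assms by (auto simp: poly_eq_iff coeff_map_poly polys_overD)
qed

lemma map_poly_of_rat_in_polys_over: "map_poly of_rat g \<in> polys_over (\<rat> :: complex set)"
  by (auto simp: polys_over_def coeff_map_poly)

lemma map_poly_of_rat_mult:
  "map_poly of_rat (f * g) = (map_poly of_rat f * map_poly of_rat g :: complex poly)"
  by (auto simp: poly_eq_iff coeff_map_poly coeff_mult of_rat_sum of_rat_mult)

lemma degree_map_poly_of_rat: "degree (map_poly of_rat f :: complex poly) = degree f"
  by (rule degree_map_poly) auto

text \<open>An irreducible rational polynomial vanishing at \<open>x\<close> is a constant multiple
  of the minimal polynomial, so a conjugate is a root of the minimal polynomial and of all its
  multiples.\<close>

lemma conjugates_poly_eq_0:
  assumes y: "y \<in> conjugates x" and f: "f \<in> polys_over \<rat>" "poly f x = 0"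
  shows "poly f y = 0"
proof (cases "f = 0")
  case False
  interpret algebraic_subfield "\<rat> :: complex set"
    by (rule algebraic_subfield_Rats)
  obtain p :: "rat poly" where p: "irreducible p" "poly (map_poly of_rat p) x = 0" "poly (map_poly of_rat p) y = 0"
    using y by (auto simp: conjugates_def)
  have "algebraic x"
    using f False by (intro algebraicI'[of f]) (auto dest: polys_overD)
  then obtain m where m: "m \<in> polys_over \<rat>" "degree m > 0"
    "\<And>f. f \<in> polys_over \<rat> \<Longrightarrow> poly f x = 0 \<Longrightarrow> \<exists>q\<in>polys_over \<rat>. f = q * m"
    using minimal_polynomial by metis
  obtain q where q: "q \<in> polys_over \<rat>" "map_poly of_rat p = q * m"
    using m(3)[OF map_poly_of_rat_in_polys_over p(2)] by blast
  obtain m' where m': "m = map_poly of_rat m'"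
    using m(1) by (rule polys_over_Rats)
  obtain q' where q': "q = map_poly of_rat q'"
    using q(1) by (rule polys_over_Rats)
  have "map_poly of_rat p = (map_poly of_rat (q' * m') :: complex poly)"
    using q(2) by (simp add: m' q' map_poly_of_rat_mult)
  then have "p = q' * m'"
    by (auto simp: poly_eq_iff coeff_map_poly)
  then have "is_unit q' \<or> is_unit m'"
    using irreducibleD[OF p(1)] by blast
  moreover have "degree m' > 0"
    using m(2) by (simp add: m' degree_map_poly_of_rat)
  ultimately have "is_unit q'"
    by (auto simp: is_unit_iff_degree)
  then have "q' \<noteq> 0" "degree q' = 0"
    by (auto simp: is_unit_iff_degree)
  then obtain c where c: "q' = [:c:]" "c \<noteq> 0"
    by (metis degree_eq_zeroE pCons_0_0)
  have "q = [:of_rat c:]"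
    unfolding q' c(1) by (intro poly_eqI) (simp add: coeff_map_poly coeff_pCons split: nat.split)
  then have "poly m y = 0"
    using p(3) c(2) by (simp add: q(2))
  then show ?thesis
    using m(3)[OF f] by auto
qed simp

text \<open>Converse of \<open>conjugates_poly_eq_0\<close>. The minimal polynomial is the
  irreducible witness: one of the factors in any factorisation vanishes at \<open>x\<close> and thus
  has full degree.\<close>

lemma conjugatesI:
  assumes "algebraic x" and y: "\<And>f. f \<in> polys_over \<rat> \<Longrightarrow> poly f x = 0 \<Longrightarrow> poly f y = 0"
  shows "y \<in> conjugates x"
proof -
  interpret algebraic_subfield "\<rat> :: complex set"
    by (rule algebraic_subfield_Rats)
  obtain m where m: "m \<in> polys_over \<rat>" "poly m x = 0" "degree m > 0"
    "\<And>f. f \<in> polys_over \<rat> \<Longrightarrow> poly f x = 0 \<Longrightarrow> f \<noteq> 0 \<Longrightarrow> degree m \<le> degree f"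
    using minimal_polynomial[OF assms(1)] by metis
  obtain g where g: "m = map_poly of_rat g"
    using m(1) by (rule polys_over_Rats)
  have min: "degree g \<le> degree f" if "poly (map_poly of_rat f) x = 0" "f \<noteq> 0" for f
  proof -
    have "map_poly of_rat f \<noteq> (0 :: complex poly)"
      using that(2) by (auto simp: poly_eq_iff coeff_map_poly)
    with m(4)[OF map_poly_of_rat_in_polys_over that(1)] show ?thesis
      by (simp add: g degree_map_poly_of_rat)
  qed
  have "irreducible g"
  proof (rule irreducibleI)
    show "g \<noteq> 0" "\<not> is_unit g"
      using m(3) by (auto simp: g degree_map_poly_of_rat is_unit_iff_degree)
  next
    fix a b assume ab: "g = a * b"
    then have nz: "a \<noteq> 0" "b \<noteq> 0"
      using m(3) by (auto simp: g degree_map_poly_of_rat)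
    have "poly (map_poly of_rat a) x = 0 \<or> poly (map_poly of_rat b) x = 0"
      using m(2) by (simp add: g ab map_poly_of_rat_mult)
    then have "degree g \<le> degree a \<or> degree g \<le> degree b"
      using min nz by blast
    then show "is_unit a \<or> is_unit b"
      using nz by (auto simp: ab degree_mult_eq is_unit_iff_degree)
  qed
  with m y[OF m(1)] show ?thesis
    unfolding conjugates_def g by blast
qed

text \<open>Embeddings fix the rationals and therefore preserve every rational relation of
  \<open>x\<close>.\<close>

lemma (in embedded_field) embedding_in_conjugates:
  assumes "x \<in> K"
  shows "\<sigma> x \<in> conjugates x"
proof (rule conjugatesI)
  fix f :: "complex poly" assume f: "f \<in> polys_over \<rat>" "poly f x = 0"
  have "map_poly \<sigma> f = f"
    using f by (auto simp: poly_eq_iff coeff_map_poly map_rat polys_overD)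
  moreover have "f \<in> polys_over K"
    using f polys_over_mono[OF Rats_subset] by auto
  ultimately show "poly f (\<sigma> x) = 0"
    using map_poly_eval[of f x] assms f by simp
qed (use assms algebraic in auto)

text \<open>Each conjugate of \<open>z\<close> is its image under some embedding. The elements with
  real image form a subfield, which contains \<open>x\<close> and \<open>y\<close> and therefore
  \<open>z\<close>.\<close>

lemma adjoin_totally_real:
  assumes x: "x \<in> totally_real_numbers" and y: "y \<in> totally_real_numbers"
    and z: "z \<in> adjoin (adjoin \<rat> x) y"
  shows "z \<in> totally_real_numbers"
proof -
  interpret Q: algebraic_subfield "\<rat> :: complex set"
    by (rule algebraic_subfield_Rats)
  interpret Q: embedded_field "\<rat> :: complex set" id
    by unfold_locales (auto simp: field_embedding_def)
  have alg: "algebraic x" "algebraic y"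
    using x y by (auto simp: totally_real_numbers_def)
  interpret Qx: algebraic_subfield "adjoin \<rat> x"
    by (rule Q.algebraic_subfield_adjoin) fact
  interpret Qxy: algebraic_subfield "adjoin (adjoin \<rat> x) y"
    by (rule Qx.algebraic_subfield_adjoin) fact
  have alg_z: "algebraic z"
    using Qxy.algebraic z by auto
  have "z' \<in> \<real>" if z': "z' \<in> conjugates z" for z'
  proof -
    have "poly (map_poly id f) z' = 0" if "f \<in> polys_over \<rat>" "poly f z = 0" for f
      using conjugates_poly_eq_0[OF z' that] by simp
    \<comment> \<open>The tower starts with \<open>z\<close> so that its image can be prescribed as
      \<open>z'\<close>. Afterwards \<open>x\<close> and \<open>y\<close> may go to any of their
      conjugates, all of which are real.\<close>
    then obtain \<sigma>1 where \<sigma>1: "embedded_field (adjoin \<rat> z) \<sigma>1" "\<sigma>1 z = z'"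
      using Q.extend_embedding[OF alg_z] by metis
    then interpret E1: embedded_field "adjoin \<rat> z" \<sigma>1 by simp
    obtain \<sigma>2 where \<sigma>2: "embedded_field (adjoin (adjoin \<rat> z) x) \<sigma>2"
      "\<And>w. w \<in> adjoin \<rat> z \<Longrightarrow> \<sigma>2 w = \<sigma>1 w"
      using E1.exists_extension[OF alg(1)] by metis
    then interpret E2: embedded_field "adjoin (adjoin \<rat> z) x" \<sigma>2 by simp
    obtain \<sigma>3 where \<sigma>3: "embedded_field (adjoin (adjoin (adjoin \<rat> z) x) y) \<sigma>3"
      "\<And>w. w \<in> adjoin (adjoin \<rat> z) x \<Longrightarrow> \<sigma>3 w = \<sigma>2 w"
      using E2.exists_extension[OF alg(2)] by metis
    define M where "M = adjoin (adjoin (adjoin \<rat> z) x) y"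
    interpret E3: embedded_field M \<sigma>3
      using \<sigma>3 by (simp add: M_def)
    have xy: "x \<in> M" "y \<in> M"
      using E1.generator_in_adjoin E2.generator_in_adjoin E2.subset_adjoin by (auto simp: M_def)
    define R where "R = {w \<in> M. \<sigma>3 w \<in> \<real>}"
    have R: "is_subfield R"
      unfolding is_subfield_def R_def
      by (auto simp: E3.map_add E3.map_mult E3.map_uminus E3.map_inverse
          E3.add_closed E3.mult_closed E3.uminus_closed E3.inverse_closed)
    then interpret R: complex_subfield R
      by unfold_locales
    have "x \<in> R" "y \<in> R"
      using x y xy E3.embedding_in_conjugates by (auto simp: R_def totally_real_numbers_def)
    then have "adjoin (adjoin \<rat> x) y \<subseteq> R"
      using R R.Rats_subset by (intro Qx.adjoin_subset Q.adjoin_subset)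
    then have "\<sigma>3 z \<in> \<real>"
      using z by (auto simp: R_def)
    moreover have "\<sigma>3 z = z'"
    proof -
      have "z \<in> adjoin (adjoin \<rat> z) x"
        by (rule subsetD[OF E1.subset_adjoin Q.generator_in_adjoin])
      then show ?thesis
        by (simp add: \<sigma>1(2) \<sigma>2(2)[OF Q.generator_in_adjoin] \<sigma>3(2))
    qed
    ultimately show ?thesis by simp
  qed
  with alg_z show ?thesis
    by (auto simp: totally_real_numbers_def)
qed

lemma algebraic_subfield_totally_real_numbers: "algebraic_subfield totally_real_numbers"
proof
  have closed: "x + y \<in> totally_real_numbers" "x * y \<in> totally_real_numbers"
    "- x \<in> totally_real_numbers" "inverse x \<in> totally_real_numbers"
    if xy: "x \<in> totally_real_numbers" "y \<in> totally_real_numbers" for x y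
  proof -
    interpret Q: algebraic_subfield "\<rat> :: complex set"
      by (rule algebraic_subfield_Rats)
    interpret Qx: algebraic_subfield "adjoin \<rat> x"
      using xy by (intro Q.algebraic_subfield_adjoin) (auto simp: totally_real_numbers_def)
    interpret Qxy: algebraic_subfield "adjoin (adjoin \<rat> x) y"
      using xy by (intro Qx.algebraic_subfield_adjoin) (auto simp: totally_real_numbers_def)
    have "x \<in> adjoin (adjoin \<rat> x) y" "y \<in> adjoin (adjoin \<rat> x) y"
      using Q.generator_in_adjoin Qx.generator_in_adjoin Qx.subset_adjoin by auto
    then show "x + y \<in> totally_real_numbers" "x * y \<in> totally_real_numbers"
      "- x \<in> totally_real_numbers" "inverse x \<in> totally_real_numbers"
      using adjoin_totally_real[OF xy] by blast+
  qed
  have 0: "0 \<in> totally_real_numbers"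
    by (auto simp: totally_real_numbers_def conjugates_0)
  interpret Q: algebraic_subfield "\<rat> :: complex set"
    by (rule algebraic_subfield_Rats)
  interpret Q0: algebraic_subfield "adjoin \<rat> 0"
    by (rule Q.algebraic_subfield_adjoin) simp
  have "1 \<in> totally_real_numbers"
    using Q0.subset_adjoin by (intro adjoin_totally_real[OF 0 0]) auto
  with 0 closed show "is_subfield totally_real_numbers"
    by (auto simp: is_subfield_def)
qed (auto simp: totally_real_numbers_def)

section \<open>Primes unramified in a field\<close>

text \<open>For a number field this says that \<open>p\<close> generates a radical ideal of the ring of integers.\<close>
definition unramified_at :: "complex set \<Rightarrow> nat \<Rightarrow> bool" where
  "unramified_at K p \<longleftrightarrow>
     (\<forall>y\<in>K. \<forall>k>0. algebraic_int (y ^ k / of_nat p) \<longrightarrow> algebraic_int (y / of_nat p))"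

lemma algebraic_int_powerD:
  fixes x :: complex
  assumes "algebraic_int (x ^ k)" "k > 0"
  shows "algebraic_int x"
  by (rule algebraic_int_root[OF assms(1), of "monom 1 k"])
     (use assms(2) in \<open>auto simp: poly_monom degree_monom_eq\<close>)

lemma algebraic_int_power_divideD:
  fixes x :: complex
  assumes "algebraic_int (x ^ k / of_nat p)" "k > 0" "p > 0"
  shows "algebraic_int x"
proof -
  have "algebraic_int (x ^ k / of_nat p * of_nat p)"
    by (rule algebraic_int_times[OF assms(1)]) auto
  then have "algebraic_int (x ^ k)"
    using assms(3) by simp
  then show ?thesis
    using assms(2) by (rule algebraic_int_powerD)
qed

lemma unramified_at_Rats:
  assumes "prime p"
  shows "unramified_at \<rat> p"
  unfolding unramified_at_def
proof (intro ballI allI impI)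
  fix y :: complex and k :: nat
  assume y: "y \<in> \<rat>" and k: "k > 0" and int: "algebraic_int (y ^ k / of_nat p)"
  have p: "p > 0"
    using assms prime_gt_0_nat by blast
  have "y \<in> \<int>"
    using rational_algebraic_int_is_int[OF algebraic_int_power_divideD[OF int k p] y] .
  then obtain n where n: "y = of_int n"
    by (elim Ints_cases)
  have "y ^ k / of_nat p \<in> \<int>"
    using int y by (intro rational_algebraic_int_is_int) auto
  then obtain j where "y ^ k / of_nat p = of_int j"
    by (elim Ints_cases)
  then have "(of_int (n ^ k) :: complex) = of_int (int p * j)"
    using p by (simp add: n field_simps)
  then have "n ^ k = int p * j"
    by (rule of_int_eq_iff[THEN iffD1])
  then have "int p dvd n ^ k"
    by simp
  then have "int p dvd n"
    using assms by (metis prime_dvd_power prime_nat_int_transfer)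
  then obtain i where "n = int p * i" ..
  then show "algebraic_int (y / of_nat p)"
    using p by (simp add: n)
qed

text \<open>The usual denominators are the values \<open>m'(z)\<close>, the products of the
  differences to the other roots. Replacing them by factors \<open>b z\<close> lets the integrality
  of the coefficients of \<open>f\<close> be read off.\<close>

lemma lagrange_interpolation_monic:
  fixes m f :: "'a :: field poly"
  assumes R: "finite R" "m = (\<Prod>z\<in>R. [:- z, 1:])" "degree f < card R"
    and b: "\<And>z. z \<in> R \<Longrightarrow> b z * poly (pderiv m) z = 1"
  shows "f = (\<Sum>z\<in>R. Polynomial.smult (poly f z * b z) (\<Prod>x\<in>R - {z}. [:- x, 1:]))"
    (is "f = ?S")
proof (rule poly_eqI_degree[of R])
  fix w assume w: "w \<in> R"
  let ?q = "\<lambda>z. \<Prod>x\<in>R - {z}. [:- x, 1:]"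
  have "m = [:- w, 1:] * ?q w"
    using w R by (simp add: prod.remove)
  then have "pderiv m = [:- w, 1:] * pderiv (?q w) + ?q w * pderiv [:- w, 1:]"
    by (simp only: pderiv_mult)
  then have "poly (pderiv m) w = poly (?q w) w"
    by (simp add: pderiv_pCons)
  with b[OF w] have "b w * poly (?q w) w = 1"
    by simp
  moreover have "poly (?q z) w = 0" if "z \<in> R - {w}" for z
    using R w that by (auto simp: poly_prod)
  then have "poly ?S w = poly f w * b w * poly (?q w) w"
    using w R by (simp add: poly_sum sum.remove)
  ultimately show "poly f w = poly ?S w"
    by (simp add: mult.assoc)
next
  have "degree (\<Prod>x\<in>R - {z}. [:- x, 1:]) = card R - 1" if "z \<in> R" for z
    using that R(1) by (subst degree_prod_sum_eq) auto
  then have "degree ?S \<le> card R - 1"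
    using R(1) by (intro degree_sum_le) auto
  then show "degree ?S < card R"
    using R(3) by linarith
qed (use R in auto)

context algebraic_subfield
begin

text \<open>If \<open>y = f(a)\<close>, interpolation recovers the coefficients of \<open>f\<close>
  from the conjugates \<open>f(z)\<close>, at the cost of factors \<open>1 / m'(z)\<close> whose
  denominators \<open>D\<close> clears. Divisibility of the conjugates thus passes to the
  coefficients, where the hypothesis on \<open>K\<close> applies.\<close>

lemma unramified_at_adjoin_integral:
  assumes a: "algebraic_int a"
  obtains D :: int where "D \<noteq> 0"
    "\<And>p. prime p \<Longrightarrow> \<not> int p dvd D \<Longrightarrow> unramified_at K p \<Longrightarrow> unramified_at (adjoin K a) p"
proof -
  have alg: "algebraic a"
    using a by auto
  obtain m where m: "m \<in> polys_over K" "lead_coeff m = 1" "poly m a = 0" "degree m > 0"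
    "\<And>f. f \<in> polys_over K \<Longrightarrow> poly f a = 0 \<Longrightarrow> \<exists>q\<in>polys_over K. f = q * m"
    "\<And>f. f \<in> polys_over K \<Longrightarrow> poly f a = 0 \<Longrightarrow> f \<noteq> 0 \<Longrightarrow> degree m \<le> degree f"
    by (rule minimal_polynomial[OF alg]) (rule that; blast)
  define R where "R = {z. poly m z = 0}"
  have conj: "poly f z = 0" if "f \<in> polys_over K" "poly f a = 0" "z \<in> R" for f z
    using m(5)[OF that(1,2)] that(3) by (auto simp: R_def)
  have m0: "m \<noteq> 0"
    using m(4) by auto
  have "pderiv m \<noteq> 0"
    using m(4) by (simp add: pderiv_eq_0_iff)
  then have "poly (pderiv m) a \<noteq> 0"
    using m(6)[OF polys_over_pderiv[OF m(1)]] m(4) by (auto simp: degree_pderiv)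
  interpret Ka: algebraic_subfield "adjoin K a"
    by (rule algebraic_subfield_adjoin[OF alg])
  have "inverse (poly (pderiv m) a) \<in> adjoin K a"
    using m(1) by blast
  \<comment> \<open>The identity \<open>b(a) * m'(a) = 1\<close> is a relation over
    \<open>K\<close>, so it holds at every root of \<open>m\<close>: one polynomial inverts all the
    values \<open>m'(z)\<close>.\<close>
  then obtain b where b: "b \<in> polys_over K" "inverse (poly (pderiv m) a) = poly b a"
    by (auto simp: adjoin_def)
  have inv: "poly b z * poly (pderiv m) z = 1" if "z \<in> R" for z
  proof -
    have "poly (b * pderiv m - 1) a = 0"
      using \<open>poly (pderiv m) a \<noteq> 0\<close> by (simp flip: b(2))
    then have "poly (b * pderiv m - 1) z = 0"
      using b(1) m(1) that by (intro conj[of "b * pderiv m - 1" z]) auto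
    then show ?thesis by simp
  qed
  then have "rsquarefree m"
    unfolding rsquarefree_roots using R_def by fastforce
  then have m_prod: "m = (\<Prod>z\<in>R. [:- z, 1:])"
    using complex_poly_decompose_rsquarefree[of m] m(2) by (simp add: R_def)
  have R: "finite R"
    using m0 by (simp add: R_def poly_roots_finite)
  have deg_m: "degree m = card R"
    unfolding m_prod by (subst degree_prod_eq_sum_degree) auto
  obtain w where w: "lead_coeff w = 1" "\<forall>i. coeff w i \<in> \<int>" "poly w a = 0"
    using a by (auto simp: algebraic_int.simps)
  have "w \<in> polys_over K"
    using w(2) by (rule polys_over_Ints)
  then have int_R: "algebraic_int z" if "z \<in> R" for z
    using conj[OF _ w(3) that] w by (intro algebraic_int.intros[of w]) auto
  have int_coeff: "algebraic_int (coeff (\<Prod>x\<in>R - {z}. [:- x, 1:]) i)" for z i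
  proof -
    have "finite (R - {z})"
      using R by simp
    then obtain xs where xs: "set xs = R - {z}" "distinct xs"
      using finite_distinct_list by blast
    have "(\<Prod>x\<leftarrow>xs. [:- x, 1:]) = (\<Prod>x\<in>R - {z}. [:- x, 1:])"
      using xs prod.distinct_set_conv_list by metis
    then show ?thesis
      using algebraic_int_coeff_prod_list[of xs i] xs int_R by auto
  qed
  obtain D where D: "D \<noteq> 0" "\<And>i. algebraic_int (of_int D * coeff b i)"
    using clear_denominators_poly[of b] polys_overD[OF b(1)] algebraic by blast
  have int_b: "algebraic_int (of_int D * poly b z)" if "z \<in> R" for z
    using algebraic_int_poly[of "Polynomial.smult (of_int D) b" z] D int_R that by simp
  have "unramified_at (adjoin K a) p" if p: "prime p" "\<not> int p dvd D" and U: "unramified_at K p" for p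
    unfolding unramified_at_def
  proof (intro ballI allI impI)
    fix y k assume y: "y \<in> adjoin K a" and k: "k > 0" and int: "algebraic_int (y ^ k / of_nat p)"
    have p0: "p > 0"
      using p prime_gt_0_nat by blast
    obtain f where f: "f \<in> polys_over K" "y = poly f a" "degree f < degree m"
      using adjoin_reduce[OF y m(1-4)] .
    \<comment> \<open>With a \<open>k\<close>-th root of \<open>p\<close>, integrality of
      \<open>f(z) ^ k / p\<close> becomes integrality of \<open>f(z) / \<rho>\<close>. This
      condition is linear and survives the sums of the interpolation formula.\<close>
    define \<rho> where "\<rho> = complex_of_real (root k (real p))"
    have \<rho>: "\<rho> ^ k = of_nat p"
      using k p0 by (simp add: \<rho>_def flip: of_real_power)
    have \<rho>0: "\<rho> \<noteq> 0"
      using \<rho> k p0 by (auto simp: power_0_left)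
    have int_f: "algebraic_int (poly f z / \<rho>)" if "z \<in> R" for z
    proof -
      obtain w where w: "lead_coeff w = 1" "\<forall>i. coeff w i \<in> \<int>" "poly w (y ^ k / of_nat p) = 0"
        using int by (auto simp: algebraic_int.simps)
      \<comment> \<open>A polynomial over \<open>K\<close> that vanishes at \<open>x\<close> exactly
        if \<open>f(x) ^ k / p\<close> is a root of the monic integer polynomial \<open>w\<close>.
        Its vanishing carries over from \<open>a\<close> to every \<open>z\<close>.\<close>
      define h where "h = pcompose w (Polynomial.smult (inverse (of_nat p)) (f ^ k))"
      have h: "poly h x = poly w (poly f x ^ k / of_nat p)" for x
        by (simp add: h_def poly_pcompose divide_inverse mult.commute)
      have "w \<in> polys_over K"
        using w(2) by (rule polys_over_Ints)
      then have "h \<in> polys_over K"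
        using f(1) by (auto simp: h_def)
      then have "poly h z = 0"
        using w f(2) that by (intro conj[of h z]) (auto simp: h)
      then have "poly w (poly f z ^ k / of_nat p) = 0"
        by (simp add: h)
      with w have "algebraic_int (poly f z ^ k / of_nat p)"
        by (intro algebraic_int.intros[of w]) auto
      then have "algebraic_int ((poly f z / \<rho>) ^ k)"
        by (simp add: power_divide \<rho>)
      then show ?thesis
        using k by (rule algebraic_int_powerD)
    qed
    have "algebraic_int (of_int D * coeff f i / of_nat p)" for i
    proof -
      let ?q = "\<lambda>z. \<Prod>x\<in>R - {z}. [:- x, 1:]"
      have "f = (\<Sum>z\<in>R. Polynomial.smult (poly f z * poly b z) (?q z))"
        using f(3) by (intro lagrange_interpolation_monic[OF R m_prod _ inv]) (simp_all add: deg_m)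
      then have "coeff f i = (\<Sum>z\<in>R. poly f z * poly b z * coeff (?q z) i)"
        by (metis (no_types, lifting) coeff_smult coeff_sum sum.cong)
      then have "of_int D * coeff f i / \<rho> =
          (\<Sum>z\<in>R. (poly f z / \<rho>) * (of_int D * poly b z) * coeff (?q z) i)"
        by (simp add: sum_distrib_left sum_divide_distrib mult_ac)
      also have "algebraic_int \<dots>"
        by (intro algebraic_int_sum algebraic_int_times[OF algebraic_int_times] int_f int_b int_coeff)
      \<comment> \<open>The \<open>k\<close>-th power removes \<open>\<rho>\<close>, which may lie
        outside \<open>K\<close>, so that unramifiedness of \<open>K\<close> applies to
        \<open>D * coeff f i\<close>.\<close>
      finally have "algebraic_int ((of_int D * coeff f i / \<rho>) ^ k)"
        by (rule algebraic_int_power)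
      then have "algebraic_int ((of_int D * coeff f i) ^ k / of_nat p)"
        by (simp add: power_divide \<rho>)
      then show ?thesis
        using U k polys_overD[OF f(1), of i] unfolding unramified_at_def by blast
    qed
    then have "algebraic_int (poly (Polynomial.smult (of_int D / of_nat p) f) a)"
      using a by (intro algebraic_int_poly) auto
    then have Dy: "algebraic_int (of_int D * y / of_nat p)"
      by (simp add: f(2))
    have "coprime (int p) D"
      using p by (simp add: prime_imp_coprime)
    \<comment> \<open>As \<open>D\<close> is invertible modulo \<open>p\<close>, it can be removed:
      \<open>y / p = u * (D * y / p) + v * y\<close>.\<close>
    then obtain u v where uv: "u * D + v * int p = 1"
      using bezout_int[of D "int p"] by (auto simp: coprime_iff_gcd_eq_1 gcd.commute)
    have "algebraic_int (of_int u * (of_int D * y / of_nat p) + of_int v * y)"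
      using algebraic_int_power_divideD[OF int k p0]
      by (intro algebraic_int_plus algebraic_int_times[OF _ Dy] algebraic_int_times[of "of_int v" y]) auto
    also have "of_int u * (of_int D * y / of_nat p) + of_int v * y = of_int (u * D + v * int p) * y / of_nat p"
      using p0 by (simp add: field_simps)
    finally show "algebraic_int (y / of_nat p)"
      by (simp only: uv of_int_1 mult_1)
  qed
  with D(1) that show ?thesis by blast
qed

text \<open>An integral multiple \<open>N * a\<close> with \<open>N\<close> nonzero generates the
  same field.\<close>

lemma unramified_at_adjoin:
  assumes a: "algebraic a"
  obtains D :: int where "D \<noteq> 0"
    "\<And>p. prime p \<Longrightarrow> \<not> int p dvd D \<Longrightarrow> unramified_at K p \<Longrightarrow> unramified_at (adjoin K a) p"
proof -
  obtain N where N: "N \<noteq> 0" "algebraic_int (of_int N * a)"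
    using a by (rule algebraic_int_clear_denominator)
  have alg: "algebraic (of_int N * a)"
    using N by auto
  interpret A: algebraic_subfield "adjoin K a"
    by (rule algebraic_subfield_adjoin[OF a])
  interpret B: algebraic_subfield "adjoin K (of_int N * a)"
    by (rule algebraic_subfield_adjoin[OF alg])
  have "adjoin K a = adjoin K (of_int N * a)"
  proof
    have "inverse (of_int N) * (of_int N * a) \<in> adjoin K (of_int N * a)"
      by (intro B.mult_closed B.inverse_closed B.of_int_closed generator_in_adjoin)
    moreover have "inverse (of_int N) * (of_int N * a) = a"
      using N(1) by simp
    ultimately have "a \<in> adjoin K (of_int N * a)"
      by (simp only:)
    then show "adjoin K a \<subseteq> adjoin K (of_int N * a)"
      by (intro adjoin_subset B.is_subfield subset_adjoin)
    show "adjoin K (of_int N * a) \<subseteq> adjoin K a"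
      by (intro adjoin_subset A.is_subfield subset_adjoin A.mult_closed A.of_int_closed generator_in_adjoin)
  qed
  then show ?thesis
    using unramified_at_adjoin_integral[OF N(2)] that by metis
qed

end

section \<open>Fields generated by finitely many algebraic numbers\<close>

definition adjoin_list :: "complex list \<Rightarrow> complex set" where
  "adjoin_list xs = foldr (\<lambda>a K. adjoin K a) xs \<rat>"

lemma adjoin_list_simps [simp]:
  "adjoin_list [] = \<rat>" "adjoin_list (a # xs) = adjoin (adjoin_list xs) a"
  by (simp_all add: adjoin_list_def)

lemma algebraic_subfield_adjoin_list:
  "(\<And>x. x \<in> set xs \<Longrightarrow> algebraic x) \<Longrightarrow> algebraic_subfield (adjoin_list xs)"
  by (induction xs) (auto intro: algebraic_subfield_Rats algebraic_subfield.algebraic_subfield_adjoin)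

lemma set_subset_adjoin_list:
  "(\<And>x. x \<in> set xs \<Longrightarrow> algebraic x) \<Longrightarrow> set xs \<subseteq> adjoin_list xs"
proof (induction xs)
  case (Cons a xs)
  interpret algebraic_subfield "adjoin_list xs"
    by (rule algebraic_subfield_adjoin_list) (use Cons in auto)
  have "set xs \<subseteq> adjoin_list xs"
    using Cons by simp
  then show ?case
    using generator_in_adjoin[of a] subset_adjoin[of a] by auto
qed auto

lemma adjoin_list_subset:
  assumes "is_subfield F" "set xs \<subseteq> F" "F \<subseteq> {x. algebraic x}"
  shows "adjoin_list xs \<subseteq> F"
  using assms(2)
proof (induction xs)
  case Nil
  interpret complex_subfield F
    by unfold_locales fact
  show ?case
    by (simp add: Rats_subset)
next
  case (Cons a xs)
  interpret algebraic_subfield "adjoin_list xs"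
    by (rule algebraic_subfield_adjoin_list) (use Cons assms in auto)
  show ?case
    using Cons adjoin_subset[OF assms(1)] by simp
qed

lemma unramified_at_adjoin_list:
  assumes "\<And>x. x \<in> set xs \<Longrightarrow> algebraic x"
  obtains D :: int where "D \<noteq> 0"
    "\<And>p. prime p \<Longrightarrow> \<not> int p dvd D \<Longrightarrow> unramified_at (adjoin_list xs) p"
  using assms
proof (induction xs arbitrary: thesis)
  case Nil
  show ?case
    by (rule Nil(1)[of 1]) (auto intro: unramified_at_Rats)
next
  case (Cons a xs)
  obtain D :: int where D: "D \<noteq> 0" "\<And>p. prime p \<Longrightarrow> \<not> int p dvd D \<Longrightarrow> unramified_at (adjoin_list xs) p"
    using Cons.IH Cons.prems(2) by (metis list.set_intros(2))
  interpret algebraic_subfield "adjoin_list xs"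
    by (rule algebraic_subfield_adjoin_list) (use Cons in auto)
  have "algebraic a"
    using Cons.prems(2) by simp
  then obtain E :: int where E: "E \<noteq> 0" "\<And>p. prime p \<Longrightarrow> \<not> int p dvd E \<Longrightarrow>
      unramified_at (adjoin_list xs) p \<Longrightarrow> unramified_at (adjoin (adjoin_list xs) a) p"
    by (rule unramified_at_adjoin) blast
  show ?case
  proof (rule Cons.prems(1)[of "D * E"])
    fix p assume "prime p" "\<not> int p dvd D * E"
    then have "\<not> int p dvd D" "\<not> int p dvd E"
      by (metis dvd_mult2, metis dvd_mult)
    with \<open>prime p\<close> show "unramified_at (adjoin_list (a # xs)) p"
      using D(2) E(2) by simp
  qed (use D E in auto)
qed

section \<open>Real cyclotomic integers\<close>

text \<open>
  \<open>cos_poly n\<close> is the Dirichlet kernel of order \<open>n\<close> as a polynomial in \<open>w + 1 / w\<close>. If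
  \<open>p = 2 * n + 1\<close> is prime then it is the minimal polynomial of \<open>2 * cos (2 * pi / p)\<close>.
\<close>
fun cos_poly :: "nat \<Rightarrow> complex poly" where
  "cos_poly 0 = 1"
| "cos_poly (Suc 0) = [:1, 1:]"
| "cos_poly (Suc (Suc n)) = pCons 0 (cos_poly (Suc n)) - cos_poly n"

lemma cos_poly_monic: "degree (cos_poly n) = n \<and> coeff (cos_poly n) n = 1"
proof (induction n rule: cos_poly.induct)
  case (3 n)
  have "coeff (cos_poly n) i = 0" if "i \<ge> Suc n" for i
    using 3 that by (intro coeff_eq_0) auto
  moreover have "coeff (cos_poly (Suc n)) i = 0" if "i \<ge> Suc (Suc n)" for i
    using 3 that by (intro coeff_eq_0) auto
  ultimately have "coeff (cos_poly (Suc (Suc n))) (Suc (Suc n)) = 1"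
    "\<And>i. i > Suc (Suc n) \<Longrightarrow> coeff (cos_poly (Suc (Suc n))) i = 0"
    using 3 by (auto simp: coeff_pCons split: nat.split)
  then show ?case
    by (metis degree_le le_antisym le_degree zero_neq_one)
qed auto

lemma degree_cos_poly [simp]: "degree (cos_poly n) = n"
  and lead_coeff_cos_poly [simp]: "coeff (cos_poly n) n = 1"
  using cos_poly_monic by auto

lemma cos_poly_nonzero [simp]: "cos_poly n \<noteq> 0"
  using lead_coeff_cos_poly[of n] by (metis coeff_0 zero_neq_one)

lemma cos_poly_Ints: "coeff (cos_poly n) i \<in> \<int>"
proof (induction n arbitrary: i rule: cos_poly.induct)
  case 1
  show ?case by (cases i) auto
next
  case 2
  show ?case by (auto simp: coeff_pCons split: nat.split)
next
  case (3 n)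
  then show ?case by (auto simp: coeff_pCons split: nat.split)
qed

text \<open>For \<open>w \<noteq> 1\<close> this identifies the value at \<open>w + 1 / w\<close>
  with the sum of \<open>w ^ k\<close> over the integers \<open>k\<close> from \<open>- n\<close> to
  \<open>n\<close>. The recurrence is multiplication of that sum by
  \<open>w + 1 / w\<close>.\<close>

lemma poly_cos_poly:
  assumes "w \<noteq> 0"
  shows "(w - 1) * w ^ n * poly (cos_poly n) (w + 1 / w) = w ^ (2 * n + 1) - 1"
proof (induction n rule: cos_poly.induct)
  case 2
  show ?case
    using assms by (simp add: field_simps power2_eq_square power3_eq_cube numeral_eq_Suc)
next
  case (3 n)
  have "(w - 1) * w ^ Suc (Suc n) * poly (cos_poly (Suc (Suc n))) (w + 1 / w)
      = w * (w + 1 / w) * ((w - 1) * w ^ Suc n * poly (cos_poly (Suc n)) (w + 1 / w))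
        - w\<^sup>2 * ((w - 1) * w ^ n * poly (cos_poly n) (w + 1 / w))"
    by (simp add: algebra_simps power2_eq_square)
  also have "\<dots> = w * (w + 1 / w) * (w ^ (2 * Suc n + 1) - 1) - w\<^sup>2 * (w ^ (2 * n + 1) - 1)"
    by (simp only: 3)
  also have "\<dots> = w ^ (2 * Suc (Suc n) + 1) - 1"
    using assms by (simp add: field_simps power2_eq_square)
  finally show ?case .
qed auto

text \<open>At \<open>w = 1\<close> the Dirichlet kernel counts its terms. This value exhibits
  \<open>2 * n + 1\<close> as the product of \<open>2 - r\<close> over the roots
  \<open>r\<close>.\<close>

lemma poly_cos_poly_2: "poly (cos_poly n) 2 = 2 * of_nat n + 1"
  by (induction n rule: cos_poly.induct) auto

lemma cos_poly_rootE:
  assumes "poly (cos_poly n) y = 0"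
  obtains w where "w ^ (2 * n + 1) = 1" "w \<noteq> 1" "w \<noteq> 0" "y = w + 1 / w"
proof -
  \<comment> \<open>Either root of \<open>w\<^sup>2 - y * w + 1\<close> serves, the other one being
    \<open>1 / w\<close>.\<close>
  define s where "s = csqrt (y\<^sup>2 - 4)"
  define w where "w = (y + s) / 2"
  have "w * (y - w) = (y\<^sup>2 - s\<^sup>2) / 4"
    by (simp add: w_def field_simps power2_eq_square)
  also have "s\<^sup>2 = y\<^sup>2 - 4"
    by (simp add: s_def)
  finally have 1: "w * (y - w) = 1"
    by simp
  then have w: "w \<noteq> 0" by auto
  with 1 have y: "y = w + 1 / w"
    by (simp add: field_simps)
  have "w \<noteq> 1"
  proof
    assume "w = 1"
    then have "poly (cos_poly n) y = 2 * of_nat n + 1"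
      by (simp add: y poly_cos_poly_2)
    also have "\<dots> \<noteq> 0"
      by (metis of_nat_Suc of_nat_mult of_nat_numeral of_nat_eq_0_iff nat.distinct(1) add.commute)
    finally show False
      using assms by simp
  qed
  moreover have "w ^ (2 * n + 1) = 1"
    using poly_cos_poly[OF w, of n] assms by (simp add: y)
  ultimately show ?thesis
    using that w y by blast
qed

section \<open>Roots of unity of prime order and total ramification\<close>

lemma algebraic_int_root_of_unity:
  fixes w :: complex
  assumes "w ^ n = 1" "n > 0"
  shows "algebraic_int w"
  using assms by (intro algebraic_int_powerD[of w n]) auto

text \<open>Since \<open>p\<close> is prime, the powers of \<open>v\<close> with exponents below
  \<open>p\<close> are distinct, and there are only \<open>p\<close> roots of unity to be
  hit.\<close>

lemma root_of_unity_prime_power: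
  fixes v w :: complex
  assumes p: "prime p" and v: "v ^ p = 1" "v \<noteq> 1" and w: "w ^ p = 1"
  obtains k where "w = v ^ k"
proof -
  have p0: "p > 0"
    using p prime_gt_0_nat by blast
  have v0: "v \<noteq> 0"
    using v p0 by (auto simp: power_0_left)
  have neq: "v ^ i \<noteq> v ^ j" if ij: "i < j" "j < p" for i j
  proof
    assume "v ^ i = v ^ j"
    also have "v ^ j = v ^ i * v ^ (j - i)"
      using ij by (simp flip: power_add)
    finally have *: "v ^ (j - i) = 1"
      using v0 by simp
    have "\<not> p dvd (j - i)"
      using ij by (auto dest!: dvd_imp_le)
    then have "coprime (j - i) p"
      using p by (metis coprime_commute prime_imp_coprime)
    \<comment> \<open>Some multiple of \<open>j - i\<close> is 1 modulo \<open>p\<close>, so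
      \<open>v ^ (j - i) = 1\<close> would give \<open>v = 1\<close>.\<close>
    then obtain x y where "(j - i) * x = p * y + 1"
      using ij coprime_bezout_strong[of "j - i" p] p prime_gt_1_nat[of p] by auto
    then have "(v ^ (j - i)) ^ x = (v ^ p) ^ y * v"
      by (metis power_mult power_add power_one_right)
    with * v show False by simp
  qed
  have inj: "inj_on (\<lambda>k. v ^ k) {..<p}"
    using neq by (intro inj_onI) (metis lessThan_iff linorder_neqE_nat)
  have "(\<lambda>k. v ^ k) ` {..<p} = {z. z ^ p = 1}"
  proof (rule card_subset_eq)
    show "finite {z :: complex. z ^ p = 1}"
      using p0 by (intro finite_roots_unity) auto
    show "(\<lambda>k. v ^ k) ` {..<p} \<subseteq> {z. z ^ p = 1}"
      using v(1) by (auto simp: power_mult[symmetric]) (metis mult.commute power_mult power_one)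
    show "card ((\<lambda>k. v ^ k) ` {..<p}) = card {z :: complex. z ^ p = 1}"
      using inj p0 by (simp add: card_image card_roots_unity_eq)
  qed
  with w that show ?thesis by blast
qed

text \<open>\<open>w\<close> is a power of \<open>v\<close>, so the quotient is a geometric sum in
  \<open>v\<close>. If also \<open>w \<noteq> 1\<close>, the roles can be exchanged and the quotient
  is a cyclotomic unit.\<close>

lemma algebraic_int_one_minus_ratio:
  fixes v w :: complex
  assumes p: "prime p" and v: "v ^ p = 1" "v \<noteq> 1" and w: "w ^ p = 1"
  shows "algebraic_int ((1 - w) / (1 - v))"
proof -
  obtain k where k: "w = v ^ k"
    using root_of_unity_prime_power[OF p v w] .
  have "(1 - w) / (1 - v) = (\<Sum>i<k. v ^ i)"
    using v(2) by (simp add: k one_diff_power_eq)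
  moreover have "algebraic_int v"
    using v p prime_gt_0_nat by (intro algebraic_int_root_of_unity) auto
  ultimately show ?thesis
    by (auto intro: algebraic_int_sum algebraic_int_power)
qed

text \<open>Since \<open>2 - (v + 1 / v) = - (1 - v)\<^sup>2 / v\<close>, the ratio is the square of
  a ratio of the previous kind times a root of unity. By symmetry in \<open>y\<close> and
  \<open>z\<close>, the numbers \<open>2 - y\<close> are pairwise associated.\<close>

lemma algebraic_int_cos_poly_roots_ratio:
  assumes p: "prime (2 * n + 1)" and y: "poly (cos_poly n) y = 0" and z: "poly (cos_poly n) z = 0"
  shows "algebraic_int ((2 - y) / (2 - z))"
proof -
  obtain v where v: "v ^ (2 * n + 1) = 1" "v \<noteq> 1" "v \<noteq> 0" "z = v + 1 / v"
    using cos_poly_rootE[OF z] .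
  obtain w where w: "w ^ (2 * n + 1) = 1" "w \<noteq> 1" "w \<noteq> 0" "y = w + 1 / w"
    using cos_poly_rootE[OF y] .
  have eq: "2 - z = - (1 - v)\<^sup>2 / v" "2 - y = - (1 - w)\<^sup>2 / w"
    using v(3) w(3) by (auto simp: v(4) w(4) field_simps power2_eq_square)
  \<comment> \<open>Writing the inverse as a power makes its integrality visible.\<close>
  have "1 / w = w ^ (2 * n)"
    using w(1,3) by (simp add: field_simps)
  moreover have "(2 - y) / (2 - z) = ((1 - w) / (1 - v))\<^sup>2 * (v * (1 / w))"
    unfolding eq by (simp add: power_divide)
  ultimately have "(2 - y) / (2 - z) = ((1 - w) / (1 - v))\<^sup>2 * (v * w ^ (2 * n))"
    by (simp only:)
  moreover have "algebraic_int v" "algebraic_int w"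
    using v w by (auto intro!: algebraic_int_root_of_unity[of _ "2 * n + 1"])
  ultimately show ?thesis
    using algebraic_int_one_minus_ratio[OF p v(1,2) w(1)]
    by (simp only:) (intro algebraic_int_times algebraic_int_power)
qed

lemma monic_complex_poly_roots:
  fixes f :: "complex poly"
  assumes "lead_coeff f = 1"
  obtains r where "\<And>i. i < degree f \<Longrightarrow> poly f (r i) = 0" "\<And>x. poly f x = (\<Prod>i<degree f. x - r i)"
proof -
  obtain r where r: "Polynomial.smult (lead_coeff f) (\<Prod>i<degree f. [:- r i, 1:]) = f"
    using complex_poly_decompose' .
  then have "f = (\<Prod>i<degree f. [:- r i, 1:])"
    by (simp add: assms)
  then have "poly f x = poly (\<Prod>i<degree f. [:- r i, 1:]) x" for x
    by simp
  then have eq: "poly f x = (\<Prod>i<degree f. x - r i)" for x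
    by (simp add: poly_prod)
  then show ?thesis
    using that by (auto simp: eq)
qed

text \<open>The prime is the product of the \<open>n\<close> numbers \<open>2 - r i\<close>, each
  associated with \<open>2 - y\<close>. So it equals \<open>(2 - y) ^ n\<close> up to a unit, which
  is total ramification.\<close>

lemma cos_poly_root_unit:
  assumes p: "prime (2 * n + 1)" and y: "poly (cos_poly n) y = 0"
  shows "algebraic_int ((2 - y) ^ n / of_nat (2 * n + 1))"
    and "algebraic_int (of_nat (2 * n + 1) / (2 - y) ^ n)"
proof -
  obtain r where r: "\<And>i. i < n \<Longrightarrow> poly (cos_poly n) (r i) = 0"
      "\<And>x. poly (cos_poly n) x = (\<Prod>i<n. x - r i)"
    using monic_complex_poly_roots[of "cos_poly n"] by auto
  have "of_nat (2 * n + 1) = (\<Prod>i<n. 2 - r i)"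
    using r(2)[of 2] by (simp add: poly_cos_poly_2 add.commute)
  then have "(2 - y) ^ n / of_nat (2 * n + 1) = (\<Prod>i<n. (2 - y) / (2 - r i))"
    "of_nat (2 * n + 1) / (2 - y) ^ n = (\<Prod>i<n. (2 - r i) / (2 - y))"
    by (simp_all add: prod_dividef)
  then show "algebraic_int ((2 - y) ^ n / of_nat (2 * n + 1))"
    "algebraic_int (of_nat (2 * n + 1) / (2 - y) ^ n)"
    using algebraic_int_cos_poly_roots_ratio[OF p] y r(1)
    by (auto intro!: algebraic_int_prod)
qed


lemma (in algebraic_subfield) cos_poly_root_degree:
  assumes p: "prime (2 * n + 1)" and U: "unramified_at K (2 * n + 1)"
    and c: "poly (cos_poly n) c = 0" and f: "f \<in> polys_over K" "f \<noteq> 0" "poly f c = 0"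
  shows "n \<le> degree f"
proof (rule ccontr)
  assume "\<not> n \<le> degree f"
  then have less: "degree f < n" by simp
  have G: "cos_poly n \<in> polys_over K"
    using cos_poly_Ints by (intro polys_over_Ints) auto
  have "algebraic c"
    using c cos_poly_Ints less by (intro algebraicI[of "cos_poly n"]) auto
  then obtain u where u: "u \<in> polys_over K" "lead_coeff u = 1" "degree u > 0"
    "\<And>f. f \<in> polys_over K \<Longrightarrow> poly f c = 0 \<Longrightarrow> \<exists>q\<in>polys_over K. f = q * u"
    "\<And>f. f \<in> polys_over K \<Longrightarrow> poly f c = 0 \<Longrightarrow> f \<noteq> 0 \<Longrightarrow> degree u \<le> degree f"
    by (rule minimal_polynomial) (rule that; blast)
  define e where "e = degree u"
  define P where "P = complex_of_nat (2 * n + 1)"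
  have P0: "P \<noteq> 0"
    unfolding P_def of_nat_eq_0_iff by simp
  have e: "e > 0" "e < n"
    using u(3) u(5)[OF f(1,3,2)] less by (auto simp: e_def)
  obtain s where s: "\<And>i. i < e \<Longrightarrow> poly u (s i) = 0" "\<And>x. poly u x = (\<Prod>i<e. x - s i)"
    using monic_complex_poly_roots[OF u(2)] by (auto simp: e_def)
  have root: "poly (cos_poly n) (s i) = 0" if "i < e" for i
    using u(4)[OF G c] s(1)[OF that] by auto
  \<comment> \<open>The norm of \<open>2 - c\<close> down to \<open>K\<close>: the value at 2 of the
    minimal polynomial \<open>u\<close>, hence the product of the \<open>e\<close> factors
    \<open>2 - s i\<close>.\<close>
  define N where "N = poly u 2"
  have N: "N \<in> K" "N = (\<Prod>i<e. 2 - s i)"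
    using poly_closed[OF u(1) of_nat_closed[of 2]] s(2)[of 2] by (simp_all add: N_def)
  have P_int: "algebraic_int (P ^ i)" for i
    unfolding P_def by (intro algebraic_int_power algebraic_int_of_nat)
  have unit: "algebraic_int ((2 - s i) ^ n / P)" "algebraic_int (P / (2 - s i) ^ n)" if "i < e" for i
    unfolding P_def using cos_poly_root_unit[OF p root[OF that]] by blast+
  \<comment> \<open>Up to a unit \<open>N ^ n\<close> is \<open>P ^ e\<close>, and
    \<open>e > 0\<close>, so \<open>P\<close> divides \<open>N ^ n\<close>; unramifiedness lowers
    this to \<open>P\<close> dividing \<open>N\<close>.\<close>
  have "N ^ n / P = (\<Prod>i<e. (2 - s i) ^ n / P) * P ^ (e - 1)"
    using e P0 by (simp add: N(2) prod_dividef prod_power_distrib power_diff)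
  also have "algebraic_int \<dots>"
    by (intro algebraic_int_times algebraic_int_prod P_int unit) simp
  finally have "algebraic_int (N / P)"
    using U N(1) e unfolding unramified_at_def P_def by (metis less_trans)
  have "2 - s i \<noteq> 0" if "i < e" for i
  proof
    assume "2 - s i = 0"
    then have "poly (cos_poly n) 2 = 0"
      using root[OF that] by simp
    then have "P = 0"
      by (simp add: P_def poly_cos_poly_2 add.commute)
    with P0 show False by simp
  qed
  then have N0: "N \<noteq> 0"
    by (auto simp: N(2))
  \<comment> \<open>Now \<open>P ^ n\<close> divides \<open>N ^ n\<close>, hence
    \<open>P ^ e\<close>. As \<open>e < n\<close>, multiplying by \<open>P ^ (n - e - 1)\<close>
    turns the quotient into exactly \<open>1 / P\<close>.\<close>
  have "algebraic_int ((N / P) ^ n * (\<Prod>i<e. P / (2 - s i) ^ n) * P ^ (n - e - 1))"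
    by (intro algebraic_int_times algebraic_int_prod P_int algebraic_int_power unit \<open>algebraic_int (N / P)\<close>) simp
  also have "(\<Prod>i<e. P / (2 - s i) ^ n) = P ^ e / N ^ n"
    by (simp add: N(2) prod_dividef prod_power_distrib)
  also have "(N / P) ^ n * (P ^ e / N ^ n) * P ^ (n - e - 1) = P ^ (e + (n - e - 1)) / P ^ n"
    using N0 by (simp add: power_divide power_add)
  also have "\<dots> = P ^ (n - 1) / P ^ Suc (n - 1)"
    using e by simp
  also have "\<dots> = 1 / P"
    using P0 by simp
  finally have "algebraic_int (1 / P)" .
  then have "1 / P \<in> \<int>"
    by (intro rational_algebraic_int_is_int) (auto simp: P_def)
  then obtain k where "1 / P = of_int k"
    by (elim Ints_cases)
  then have "complex_of_int (k * int (2 * n + 1)) = of_int 1"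
    using P0 by (simp add: P_def field_simps)
  then have "k * int (2 * n + 1) = 1"
    by (rule of_int_eq_iff[THEN iffD1])
  then have "int (2 * n + 1) dvd 1"
    by (metis dvd_triv_right)
  with e show False by simp
qed

text \<open>If \<open>b = f(c)\<close> with \<open>f\<close> over \<open>K\<close> of degree below
  \<open>n\<close>, then \<open>f - b\<close> is a polynomial over K(b) vanishing at
  \<open>c\<close>. The degree bound over K(b) forces it to be zero, so \<open>b\<close> is the
  constant coefficient of \<open>f\<close> and lies in \<open>K\<close>.\<close>

lemma (in algebraic_subfield) not_in_adjoin_cos_poly_root:
  assumes p: "prime (2 * n + 1)" and b: "algebraic b" "b \<notin> K"
    and U: "unramified_at (adjoin K b) (2 * n + 1)"
    and c: "poly (cos_poly n) c = 0"
  shows "b \<notin> adjoin K c"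
proof
  assume "b \<in> adjoin K c"
  have n: "n > 0"
    using p by (cases n) auto
  have G: "cos_poly n \<in> polys_over K"
    using cos_poly_Ints by (intro polys_over_Ints) auto
  obtain f where f: "f \<in> polys_over K" "b = poly f c" "degree f < degree (cos_poly n)"
    by (rule adjoin_reduce[OF \<open>b \<in> adjoin K c\<close> G _ c]) (use n in auto)
  interpret L: algebraic_subfield "adjoin K b"
    by (rule algebraic_subfield_adjoin[OF b(1)])
  have "f \<in> polys_over (adjoin K b)"
    using f(1) polys_over_mono[OF subset_adjoin] by auto
  then have "f - [:b:] \<in> polys_over (adjoin K b)"
    using generator_in_adjoin by (intro L.polys_over_diff L.polys_over_pCons L.polys_over_0)
  moreover have "poly (f - [:b:]) c = 0"
    by (simp add: f(2))
  moreover have "degree (f - [:b:]) < n"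
    using f(3) n by (intro degree_diff_less) auto
  ultimately have "f - [:b:] = 0"
    using L.cos_poly_root_degree[OF p U c] by force
  then have "b = coeff f 0"
    by simp
  with b(2) polys_overD[OF f(1)] show False by simp
qed

section \<open>The numbers \<open>2 * cos (2 * pi / p)\<close>\<close>

definition cos_int :: "nat \<Rightarrow> complex" where
  "cos_int p = of_real (2 * cos (2 * pi / real p))"

lemma two_pi_div_le_pi: "p \<ge> 2 \<Longrightarrow> 2 * pi / real p \<le> pi"
  using divide_left_mono[of 2 "real p" "2 * pi"] by simp

text \<open>The bound 2 keeps the angle in the interval from 0 to \<open>pi\<close>, where cosine is
  injective; \<open>cos_int 0\<close> and \<open>cos_int 1\<close> are both 2.\<close>

lemma inj_on_cos_int: "inj_on cos_int {2..}"
proof (rule inj_onI)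
  fix p q :: nat assume pq: "p \<in> {2..}" "q \<in> {2..}" and eq: "cos_int p = cos_int q"
  have "2 * pi / real p = 2 * pi / real q"
  proof (rule cos_inj_pi)
    show "cos (2 * pi / real p) = cos (2 * pi / real q)"
      using eq unfolding cos_int_def by (simp only: of_real_eq_iff)
  qed (use pq two_pi_div_le_pi in auto)
  then have "real p = real q"
    using pq by (simp add: frac_eq_eq)
  then show "p = q"
    by simp
qed

lemma cos_poly_cos_int:
  assumes "n > 0"
  shows "poly (cos_poly n) (cos_int (2 * n + 1)) = 0"
proof -
  define w where "w = cis (2 * pi / real (2 * n + 1))"
  have w0: "w \<noteq> 0"
    by (simp add: w_def)
  have "w ^ (2 * n + 1) = cis (real (2 * n + 1) * (2 * pi / real (2 * n + 1)))"
    unfolding w_def by (rule Complex.DeMoivre)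
  also have "real (2 * n + 1) * (2 * pi / real (2 * n + 1)) = 2 * pi"
    by simp
  finally have "w ^ (2 * n + 1) = 1"
    by simp
  moreover have "w \<noteq> 1"
  proof
    assume "w = 1"
    then have "cos (2 * pi / real (2 * n + 1)) = cos 0"
      by (simp add: w_def complex_eq_iff)
    then have "2 * pi / real (2 * n + 1) = 0"
      by (rule cos_inj_pi[rotated 4]) (use assms two_pi_div_le_pi[of "2 * n + 1"] in auto)
    then show False by simp
  qed
  moreover have "w + 1 / w = cos_int (2 * n + 1)"
    by (simp add: w_def cos_int_def complex_eq_iff flip: inverse_eq_divide)
  ultimately show ?thesis
    using poly_cos_poly[OF w0, of n] w0 by simp
qed

text \<open>On the unit circle \<open>1 / w = cnj w\<close>, so \<open>y = 2 * Re w\<close>. The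
  bound is strict because \<open>w\<close> is neither 1 nor -1, the latter since the exponent
  \<open>2 * n + 1\<close> is odd.\<close>

lemma cos_poly_roots_real_small:
  assumes "poly (cos_poly n) y = 0"
  shows "y \<in> \<real>" "cmod y < 2"
proof -
  obtain w where w: "w ^ (2 * n + 1) = 1" "w \<noteq> 1" "w \<noteq> 0" "y = w + 1 / w"
    using cos_poly_rootE[OF assms] .
  have "cmod w ^ (2 * n + 1) = 1"
    using w(1) by (metis norm_one norm_power)
  then have norm: "cmod w = 1"
    using power_eq_imp_eq_base[of "cmod w" "2 * n + 1" 1] by simp
  then have "1 / w = cnj w"
    by (simp add: divide_conv_cnj)
  then have y: "y = of_real (2 * Re w)"
    by (simp add: w(4) complex_add_cnj)
  then show "y \<in> \<real>"
    by (simp only: Reals_of_real)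
  have sq: "(Re w)\<^sup>2 + (Im w)\<^sup>2 = 1"
    using norm by (simp add: cmod_def)
  have "\<bar>Re w\<bar> \<noteq> 1"
  proof
    assume "\<bar>Re w\<bar> = 1"
    with sq have "Im w = 0"
      by (metis add_cancel_left_right power2_abs one_power2 zero_eq_power2)
    with \<open>\<bar>Re w\<bar> = 1\<close> have "w = 1 \<or> w = - 1"
      by (auto simp: complex_eq_iff abs_if split: if_splits)
    with w(1,2) show False
      by (auto simp: power_mult)
  qed
  moreover have "\<bar>Re w\<bar> \<le> 1"
    using abs_Re_le_cmod[of w] norm by simp
  ultimately show "cmod y < 2"
    unfolding y norm_of_real by simp
qed

lemma cos_int_properties:
  assumes "n > 0"
  shows "algebraic_int (cos_int (2 * n + 1))" "cos_int (2 * n + 1) \<in> totally_real_numbers"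
    "house (cos_int (2 * n + 1)) < 2"
proof -
  let ?c = "cos_int (2 * n + 1)"
  note root = cos_poly_cos_int[OF assms]
  show "algebraic_int ?c"
    using root cos_poly_Ints by (intro algebraic_int.intros[of "cos_poly n"]) auto
  then have alg: "algebraic ?c" by auto
  have "cos_poly n \<in> polys_over \<rat>"
    using cos_poly_Ints Ints_subset_Rats by (auto simp: polys_over_def)
  then have conj: "poly (cos_poly n) y = 0" if "y \<in> conjugates ?c" for y
    using conjugates_poly_eq_0[OF that _ root] by blast
  then show "?c \<in> totally_real_numbers"
    using alg cos_poly_roots_real_small(1) by (auto simp: totally_real_numbers_def)
  have "finite (conjugates ?c)"
    using conj by (intro finite_subset[OF _ poly_roots_finite[of "cos_poly n"]]) auto
  \<comment> \<open>This keeps the maximum that defines \<open>house\<close> over a nonempty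
    set.\<close>
  moreover have "?c \<in> conjugates ?c"
    using alg by (intro conjugatesI)
  ultimately show "house ?c < 2"
    unfolding house_def using conj cos_poly_roots_real_small(2) by (subst Max_less_iff) auto
qed

section \<open>Meagerness\<close>

lemma countable_algebraic: "countable {x :: complex. algebraic x}"
proof (rule countable_subset)
  let ?f = "\<lambda>l :: int list. map_poly of_int (Poly l) :: complex poly"
  show "{x :: complex. algebraic x} \<subseteq> (\<Union>l\<in>{l. ?f l \<noteq> 0}. {x. poly (?f l) x = 0})"
  proof
    fix x :: complex assume "x \<in> {x. algebraic x}"
    then obtain p where p: "poly (map_poly of_int p) x = 0" "p \<noteq> 0"
      using algebraicE' by blast
    have "map_poly of_int p \<noteq> (0 :: complex poly)"
      using p(2) by (auto simp: poly_eq_iff coeff_map_poly)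
    with p(1) show "x \<in> (\<Union>l\<in>{l. ?f l \<noteq> 0}. {x. poly (?f l) x = 0})"
      by (intro UN_I[of "coeffs p"]) auto
  qed
  show "countable (\<Union>l\<in>{l. ?f l \<noteq> 0}. {x. poly (?f l) x = 0})"
    by (intro countable_UN) (auto intro: countable_finite poly_roots_finite)
qed

text \<open>A generator imposes or forbids a single element. Around a given \<open>K\<close>, a
  finite intersection collects finitely many such conditions, and a union needs only one of its
  members.\<close>

lemma constructible_topology_basis:
  assumes "openin constructible_topology U" "K \<in> U"
  obtains S T where "finite S" "finite T" "S \<subseteq> K" "T \<inter> K = {}"
    "S \<subseteq> totally_real_numbers" "T \<subseteq> totally_real_numbers"
    "{L \<in> totally_real_fields. S \<subseteq> L \<and> T \<inter> L = {}} \<subseteq> U"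
proof -
  let ?B = "\<Union>a\<in>totally_real_numbers. {{K \<in> totally_real_fields. a \<in> K}, {K \<in> totally_real_fields. a \<notin> K}}"
  define nbhd where "nbhd S T K \<longleftrightarrow> finite S \<and> finite T \<and> S \<subseteq> K \<and> T \<inter> K = {} \<and>
    S \<subseteq> totally_real_numbers \<and> T \<subseteq> totally_real_numbers" for S T K :: "complex set"
  define basic where "basic S T = {L \<in> totally_real_fields. S \<subseteq> L \<and> T \<inter> L = {}}" for S T
  have "generate_topology_on ?B U"
    using assms(1) by (simp add: constructible_topology_def openin_topology_generated_by_iff)
  then have "\<forall>K\<in>U. \<exists>S T. nbhd S T K \<and> basic S T \<subseteq> U"
  proof induction
    case (Int U V)
    show ?case
    proof
      fix K assume K: "K \<in> U \<inter> V"
      obtain S T where S: "nbhd S T K" "basic S T \<subseteq> U"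
        using Int.IH(1) K by blast
      obtain S' T' where S': "nbhd S' T' K" "basic S' T' \<subseteq> V"
        using Int.IH(2) K by blast
      have "nbhd (S \<union> S') (T \<union> T') K"
        using S S' by (auto simp: nbhd_def)
      moreover have "basic (S \<union> S') (T \<union> T') = basic S T \<inter> basic S' T'"
        by (auto simp: basic_def)
      ultimately show "\<exists>S T. nbhd S T K \<and> basic S T \<subseteq> U \<inter> V"
        using S(2) S'(2) by blast
    qed
  next
    case (UN \<U>)
    then show ?case
      by (meson Union_iff Union_upper order.trans)
  next
    case (Basis U)
    then obtain a where a: "a \<in> totally_real_numbers"
      "U = {K \<in> totally_real_fields. a \<in> K} \<or> U = {K \<in> totally_real_fields. a \<notin> K}"
      by blast
    then have "U = basic {a} {} \<or> U = basic {} {a}"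
      by (auto simp: basic_def)
    moreover have "nbhd {a} {} K" if "K \<in> basic {a} {}" for K
      using that a(1) by (auto simp: nbhd_def basic_def)
    moreover have "nbhd {} {a} K" if "K \<in> basic {} {a}" for K
      using that a(1) by (auto simp: nbhd_def basic_def)
    ultimately show ?case
      by blast
  qed auto
  then obtain S T where "nbhd S T K" "basic S T \<subseteq> U"
    using assms(2) by blast
  then show ?thesis
    using that[of S T] by (simp add: nbhd_def basic_def)
qed

lemma openin_constructible_topology_contains:
  assumes "a \<in> totally_real_numbers"
  shows "openin constructible_topology {K \<in> totally_real_fields. a \<in> K}"
  unfolding constructible_topology_def
  by (rule topology_generated_by_Basis) (use assms in blast)

lemma nowhere_dense_in_subset:
  "nowhere_dense_in X A \<Longrightarrow> B \<subseteq> A \<Longrightarrow> nowhere_dense_in X B"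
  unfolding nowhere_dense_in_def
  by (metis closure_of_mono interior_of_mono order.trans subset_empty)

lemma meager_in_subset:
  assumes "meager_in X A" "B \<subseteq> A"
  shows "meager_in X B"
proof -
  obtain \<F> where \<F>: "countable \<F>" "\<forall>A\<in>\<F>. nowhere_dense_in X A" "A = \<Union>\<F>"
    using assms(1) by (auto simp: meager_in_def)
  show ?thesis
    unfolding meager_in_def
  proof (intro exI conjI ballI)
    show "countable ((\<lambda>A. A \<inter> B) ` \<F>)"
      using \<F>(1) by simp
    show "nowhere_dense_in X C" if "C \<in> (\<lambda>A. A \<inter> B) ` \<F>" for C
      using that \<F>(2) by (auto intro: nowhere_dense_in_subset)
    show "B = \<Union>((\<lambda>A. A \<inter> B) ` \<F>)"
      using \<F>(3) assms(2) by auto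
  qed
qed

section \<open>Fields in a given neighbourhood that contain a new \<open>cos_int\<close>\<close>

lemma exists_prime_not_dvd_cos_int_notin:
  assumes F: "finite F" and T: "finite T" and D: "\<And>b. b \<in> T \<Longrightarrow> D b \<noteq> (0 :: int)"
  obtains n where "n > 0" "prime (2 * n + 1)" "cos_int (2 * n + 1) \<notin> F"
    "\<And>b. b \<in> T \<Longrightarrow> \<not> int (2 * n + 1) dvd D b"
proof -
  \<comment> \<open>A prime above all elements of \<open>B\<close> is odd and divides no
    \<open>D b\<close>. There are infinitely many, and injectivity of \<open>cos_int\<close> leaves
    one whose value avoids \<open>F\<close>.\<close>
  define B where "B = insert 2 ((\<lambda>b. nat \<bar>D b\<bar>) ` T)"
  have B: "finite B"
    using T by (simp add: B_def)
  have inf: "infinite {p::nat. prime p \<and> p > Max B}"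
  proof -
    have "infinite ({p::nat. prime p} - {..Max B})"
      using primes_infinite by (intro Diff_infinite_finite) auto
    moreover have "{p::nat. prime p} - {..Max B} = {p. prime p \<and> p > Max B}"
      by auto
    ultimately show ?thesis by simp
  qed
  have "{p::nat. prime p \<and> p > Max B} \<subseteq> {2..}"
    by (auto intro: prime_ge_2_nat)
  then have "infinite (cos_int ` {p. prime p \<and> p > Max B})"
    using inf inj_on_cos_int by (meson finite_imageD inj_on_subset)
  then obtain p where p: "prime p" "p > Max B" "cos_int p \<notin> F"
    using F finite_subset[of "cos_int ` {p. prime p \<and> p > Max B}" F] by blast
  have less: "x < p" if "x \<in> B" for x
    using Max_ge[OF B that] p(2) by simp
  have "p > 2"
    using less[of 2] by (simp add: B_def)
  then have "odd p"
    using p(1) prime_odd_nat by blast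
  then obtain n where n: "p = 2 * n + 1"
    by (elim oddE)
  have "\<not> int p dvd D b" if "b \<in> T" for b
  proof
    assume "int p dvd D b"
    then have "\<bar>int p\<bar> \<le> \<bar>D b\<bar>"
      using D[OF that] by (rule dvd_imp_le_int[rotated])
    moreover have "nat \<bar>D b\<bar> < p"
      using that by (intro less) (auto simp: B_def)
    ultimately show False by simp
  qed
  with p \<open>p > 2\<close> n that[of n] show ?thesis by auto
qed

lemma totally_real_extension_with_cos_int:
  assumes S: "finite S" "S \<subseteq> totally_real_numbers" and T: "finite T" "T \<subseteq> totally_real_numbers"
    and K: "is_subfield K" "K \<subseteq> totally_real_numbers" "S \<subseteq> K" "T \<inter> K = {}" and F: "finite F"
  obtains L n where "L \<in> totally_real_fields" "S \<subseteq> L" "T \<inter> L = {}"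
    "n > 0" "cos_int (2 * n + 1) \<in> L" "cos_int (2 * n + 1) \<notin> F"
proof -
  obtain xs where xs: "set xs = S"
    using finite_list[OF S(1)] by blast
  have alg: "algebraic x" if "x \<in> totally_real_numbers" for x
    using that by (simp add: totally_real_numbers_def)
  interpret TR: algebraic_subfield totally_real_numbers
    by (rule algebraic_subfield_totally_real_numbers)
  \<comment> \<open>The field \<rat>(S), a number field even if \<open>K\<close> is not. It lies
    inside \<open>K\<close>, so it avoids \<open>T\<close>.\<close>
  define K0 where "K0 = adjoin_list xs"
  interpret K0: algebraic_subfield K0
    unfolding K0_def using S xs by (intro algebraic_subfield_adjoin_list alg) auto
  have "S \<subseteq> K0"
    unfolding K0_def using S xs set_subset_adjoin_list[of xs] alg by auto
  have "K0 \<subseteq> K"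
    unfolding K0_def using K xs TR.algebraic by (intro adjoin_list_subset) auto
  have "\<exists>D :: int. D \<noteq> 0 \<and> (\<forall>p. prime p \<longrightarrow> \<not> int p dvd D \<longrightarrow> unramified_at (adjoin K0 b) p)"
    if "b \<in> T" for b
  proof -
    have *: "algebraic x" if "x \<in> set (b # xs)" for x
      using that \<open>b \<in> T\<close> S T xs alg by auto
    \<comment> \<open>The head of the list is adjoined last, so \<open>adjoin_list (b # xs)\<close>
      is \<open>adjoin K0 b\<close>.\<close>
    show ?thesis
      by (rule unramified_at_adjoin_list[of "b # xs", OF *]) (auto simp: K0_def)
  qed
  then obtain D :: "complex \<Rightarrow> int" where D: "\<And>b. b \<in> T \<Longrightarrow> D b \<noteq> 0"
    "\<And>b p. b \<in> T \<Longrightarrow> prime p \<Longrightarrow> \<not> int p dvd D b \<Longrightarrow> unramified_at (adjoin K0 b) p"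
    by metis
  obtain n where n: "n > 0" "prime (2 * n + 1)" "cos_int (2 * n + 1) \<notin> F"
    "\<And>b. b \<in> T \<Longrightarrow> \<not> int (2 * n + 1) dvd D b"
    using exists_prime_not_dvd_cos_int_notin[of F T D] F T(1) D(1) by metis
  define c where "c = cos_int (2 * n + 1)"
  have c: "c \<in> totally_real_numbers" "poly (cos_poly n) c = 0"
    using cos_int_properties(2)[OF n(1)] cos_poly_cos_int[OF n(1)] by (simp_all only: c_def)
  interpret L: algebraic_subfield "adjoin K0 c"
    by (rule K0.algebraic_subfield_adjoin[OF alg[OF c(1)]])
  \<comment> \<open>A single \<open>c\<close> serves all of \<open>T\<close>: the prime was chosen
    to be unramified in K0(b) for each of the finitely many \<open>b\<close>.\<close>
  have "b \<notin> adjoin K0 c" if "b \<in> T" for b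
    using that T K \<open>K0 \<subseteq> K\<close> n c alg
    by (intro K0.not_in_adjoin_cos_poly_root[of n] D(2)) auto
  moreover have "adjoin K0 c \<subseteq> totally_real_numbers"
    using \<open>K0 \<subseteq> K\<close> K(2) c(1) by (intro K0.adjoin_subset TR.is_subfield) auto
  ultimately show ?thesis
    using that[of "adjoin K0 c" n] n(1,3) L.is_subfield \<open>S \<subseteq> K0\<close> K0.subset_adjoin[of c] K0.generator_in_adjoin[of c]
    by (auto simp: totally_real_fields_def c_def)
qed

text \<open>For an integer \<open>c\<close> of house below 2 outside \<open>F\<close>, the fields
  containing \<open>c\<close> form an open set disjoint from the given one. Every nonempty open set
  meets one of these, with \<open>c\<close> a suitable \<open>cos_int\<close>, so it cannot lie in
  the closure.\<close>

lemma nowhere_dense_small_house_integers: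
  assumes F: "finite F"
  shows "nowhere_dense_in constructible_topology
    {K \<in> totally_real_fields. {x \<in> ring_of_integers K. house x < 2} \<subseteq> F}"
    (is "nowhere_dense_in ?X ?A")
proof -
  have "U = {}" if U: "openin ?X U" "U \<subseteq> ?X closure_of ?A" for U
  proof (rule ccontr)
    assume "U \<noteq> {}"
    then obtain K where K: "K \<in> U" by blast
    then have "K \<in> totally_real_fields"
      using openin_subset[OF U(1)] by (auto simp: topspace_constructible_topology)
    then have K_field: "is_subfield K" "K \<subseteq> totally_real_numbers"
      by (auto simp: totally_real_fields_def)
    obtain S T where ST: "finite S" "finite T" "S \<subseteq> K" "T \<inter> K = {}"
      "S \<subseteq> totally_real_numbers" "T \<subseteq> totally_real_numbers"
      "{L \<in> totally_real_fields. S \<subseteq> L \<and> T \<inter> L = {}} \<subseteq> U"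
      using constructible_topology_basis[OF U(1) K] .
    obtain L n where L: "L \<in> totally_real_fields" "S \<subseteq> L" "T \<inter> L = {}"
      "n > 0" "cos_int (2 * n + 1) \<in> L" "cos_int (2 * n + 1) \<notin> F"
      using totally_real_extension_with_cos_int[OF ST(1,5,2,6) K_field ST(3,4) F] .
    define c where "c = cos_int (2 * n + 1)"
    note c = cos_int_properties[OF L(4), folded c_def]
    have "L \<in> ?X closure_of ?A"
      using L(1-3) ST(7) U(2) by (intro subsetD[OF U(2)] subsetD[OF ST(7)]) simp
    moreover have "L \<in> {K \<in> totally_real_fields. c \<in> K} \<and> openin ?X {K \<in> totally_real_fields. c \<in> K}"
      using openin_constructible_topology_contains[OF c(2)] L(1,5) by (simp add: c_def)
    ultimately obtain M where "M \<in> ?A" "M \<in> {K \<in> totally_real_fields. c \<in> K}"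
      unfolding in_closure_of by meson
    then have M: "{x \<in> ring_of_integers M. house x < 2} \<subseteq> F" "c \<in> M"
      by simp_all
    have "c \<in> {x \<in> ring_of_integers M. house x < 2}"
      using c M(2) by (simp add: ring_of_integers_def)
    with M(1) have "c \<in> F"
      by (rule subsetD)
    with L(6) show False
      by (simp add: c_def)
  qed
  from this[OF openin_interior_of interior_of_subset]
  have "?X interior_of (?X closure_of ?A) = {}" .
  moreover have "?A \<subseteq> topspace ?X"
    unfolding topspace_constructible_topology by (rule Collect_restrict)
  ultimately show ?thesis
    unfolding nowhere_dense_in_def by blast
qed

theorem theorem5p3:
  shows "let N = {K \<in> totally_real_fields.
                    \<forall>n::nat. n > 0 \<longrightarrow> finite {x \<in> ring_of_integers K. house x < real n}};
             N' = {K \<in> totally_real_fields. finite {x \<in> ring_of_integers K. house x < 2}}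
         in meager_in constructible_topology N \<and>
            N \<subseteq> N' \<and> meager_in constructible_topology N'"
proof -
  define N where "N = {K \<in> totally_real_fields.
    \<forall>n::nat. n > 0 \<longrightarrow> finite {x \<in> ring_of_integers K. house x < real n}}"
  define N' where "N' = {K \<in> totally_real_fields. finite {x \<in> ring_of_integers K. house x < 2}}"
  define A where "A F = {K \<in> totally_real_fields. {x \<in> ring_of_integers K. house x < 2} \<subseteq> F}" for F
  \<comment> \<open>For a field in \<open>N'\<close>, its finite set of integers of small house
    serves as its own \<open>F\<close>. Restricting \<open>F\<close> to algebraic numbers keeps the
    family countable.\<close>
  define \<F> where "\<F> = A ` {F. finite F \<and> F \<subseteq> {x. algebraic x}}"
  \<comment> \<open>The instance \<open>n = 2\<close> of the condition.\<close>
  have "N \<subseteq> N'"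
    unfolding N_def N'_def using of_nat_numeral[of "num.Bit0 num.One", where 'a = real]
    by (auto dest: spec[of _ "2::nat"])
  have "countable \<F>"
    unfolding \<F>_def
    by (intro countable_image countable_Collect_finite_subset countable_algebraic)
  moreover have "\<forall>B\<in>\<F>. nowhere_dense_in constructible_topology B"
    using nowhere_dense_small_house_integers by (auto simp: \<F>_def A_def)
  moreover have "N' = \<Union>\<F>"
  proof (intro equalityI subsetI)
    fix K assume K: "K \<in> N'"
    let ?F = "{x \<in> ring_of_integers K. house x < 2}"
    have "?F \<subseteq> {x. algebraic x}"
      by (auto simp: ring_of_integers_def)
    with K show "K \<in> \<Union>\<F>"
      by (auto simp: N'_def \<F>_def A_def intro!: exI[of _ ?F])
  next
    fix K assume "K \<in> \<Union>\<F>"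
    then show "K \<in> N'"
      by (auto simp: N'_def \<F>_def A_def intro: finite_subset)
  qed
  ultimately have "meager_in constructible_topology N'"
    unfolding meager_in_def by blast
  moreover from this have "meager_in constructible_topology N"
    using \<open>N \<subseteq> N'\<close> by (rule meager_in_subset)
  ultimately show ?thesis
    using \<open>N \<subseteq> N'\<close> by (simp add: N_def N'_def Let_def)
qed

end
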